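(* Suppose that $(a,b,c)\in D$. Then there exists a unique angle $\theta$ such that $(a,b,c,\theta)$ determines a central configuration (normalized, convex, with positive masses). More precisely, the set of (normalized) four-body convex central configurations with positive masses is the graph of a differentiable function $\theta=f(a,b,c)$. The domain of this function is $D$, which is equal to the projection of $E$ onto $abc$-space, i.e. $D=\{(a,b,c) : (a,b,c,\theta)\in E \text{ for some } \theta\in(0,\pi)\}$.
   Context: Central configurations: for bodies at pairwise distinct positions $q_1,\dots,q_4\in\mathbb{R}^2$ with masses $m_1,\dots,m_4>0$, put $M=\sum_i m_i$, $r_{ij}=\|q_i-q_j\|$, $U(q)=\sum_{i<j} m_im_j/r_{ij}$ and $I(q)=\frac1M\sum_{i<j}m_im_jr_{ij}^2$. The configuration $q=(q_1,\dots,q_4)\in\mathbb{R}^8$ is a (planar) central configuration for these masses if it is a critical point of $U$ subject to the constraint $I=I_0$, where $I_0>0$ is a constant. Coordinates: a point $(a,b,c,\theta)$ with $a,b,c>0$ and $\theta\in(0,\pi)$ encodes the convex quadrilateral $q_1=(1,0)$, $q_2=(a\cos\theta,a\sin\theta)$, $q_3=(-b,0)$, $q_4=(-c\cos\theta,-c\sin\theta)$, whose diagonals (of lengths $r_{13}$ and $r_{24}$) meet at the origin. Thus $r_{12}^2=a^2-2a\cos\theta+1$, $r_{23}^2=a^2+2ab\cos\theta+b^2$, $r_{13}=b+1$, $r_{14}^2=c^2+2c\cos\theta+1$, $r_{34}^2=b^2-2bc\cos\theta+c^2$, $r_{24}=a+c$. Every convex configuration of four bodies can be put in this form by an isometry,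 a rescaling and a relabeling, and bodies are always labeled so that $r_{12}$ is the largest exterior side length. We say $(a,b,c,\theta)$ determines a normalized convex central configuration with positive masses if $r_{12}\ge r_{14},r_{23},r_{34}$ and there exist $m_1,m_2,m_3,m_4>0$ for which $(q_1,q_2,q_3,q_4)$ is a central configuration. The set $E$: let $\mathcal C$ be the set of $(a,b,c,\theta)$ with $a,b,c>0$, $\theta\in(0,\pi)$ such that $r_{13}>r_{12}$, $r_{24}>r_{12}$, $r_{12}\ge r_{14}\ge r_{34}$ and $r_{12}\ge r_{23}\ge r_{34}$. Let $F(a,b,c,\theta)=(r_{24}^3-r_{14}^3)(r_{13}^3-r_{12}^3)(r_{23}^3-r_{34}^3)-(r_{12}^3-r_{14}^3)(r_{24}^3-r_{34}^3)(r_{13}^3-r_{23}^3)$, and $E=\{s\in\mathcal C: F(s)=0\}$. The set $E$ represents the set of normalized four-body convex central configurations with positive masses. The set $D$: $D=D_1\cup D_2$, where $D_1$ is the set of $(a,b,c)$ with $a,b,c>0$, $c\le a\le 1$, $b\le1$, $\frac12(-a+\sqrt{4-3a^2})<c<\frac1a(b^2+2b)$ and $c>-a+\sqrt{a^2+b}$; and $D_2$ is the set of $(a,b,c)$ with $a,b,c>0$, $c\le a$, $a>1$, $b\le 1$, $c<\frac1a(b^2+2b)$, $b>\frac12(-1+\sqrt{4a^2-3})$ and $c>-a+\sqrt{a^2+b}$. *)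

theory Defs
  imports "HOL-Analysis.Analysis"
begin

text \<open>
  A planar four-body configuration is a vector of type \<^typ>\<open>(real^2)^4\<close>, i.e. a point of
  $R^8$. The four indices of type \<^typ>\<open>4\<close> are \<open>1, 2, 3, 4\<close>. There \<open>4 = 0\<close>, so the linear order
  is \<open>4 < 1 < 2 < 3\<close>; a sum of terms symmetric in \<open>i\<close>, \<open>j\<close> over \<open>i < j\<close> still takes each
  unordered pair exactly once.
\<close>

definition rdist :: "(real^2)^4 \<Rightarrow> 4 \<Rightarrow> 4 \<Rightarrow> real" where
  "rdist q i j = norm (q $ i - q $ j)"

definition U_pot :: "(4 \<Rightarrow> real) \<Rightarrow> (real^2)^4 \<Rightarrow> real" where
  "U_pot m q = (\<Sum>(i, j) \<in> {(i, j). i < j}. m i * m j / rdist q i j)"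

definition I_mom :: "(4 \<Rightarrow> real) \<Rightarrow> (real^2)^4 \<Rightarrow> real" where
  "I_mom m q = 1 / (\<Sum>i\<in>UNIV. m i) * (\<Sum>(i, j) \<in> {(i, j). i < j}. m i * m j * (rdist q i j)\<^sup>2)"

text \<open>
  \<open>x\<close> is a critical point of \<open>f\<close> subject to \<open>g = c\<close>: it lies on the level set, and \<open>f\<close> is
  stationary at \<open>x\<close> along every curve through \<open>x\<close> within the level set.
\<close>

definition constrained_critical_point ::
    "('a::real_normed_vector \<Rightarrow> real) \<Rightarrow> ('a \<Rightarrow> real) \<Rightarrow> real \<Rightarrow> 'a \<Rightarrow> bool" where
  "constrained_critical_point f g c x \<longleftrightarrow>
     g x = c \<and>
     (\<forall>\<gamma> :: real \<Rightarrow> 'a.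
        \<gamma> 0 = x \<and> \<gamma> differentiable (at 0) \<and> (\<forall>\<^sub>F t in nhds 0. g (\<gamma> t) = c)
        \<longrightarrow> ((\<lambda>t. f (\<gamma> t)) has_real_derivative 0) (at 0))"

definition central_configuration :: "(4 \<Rightarrow> real) \<Rightarrow> (real^2)^4 \<Rightarrow> bool" where
  "central_configuration m q \<longleftrightarrow>
     (\<forall>i. 0 < m i) \<and> (\<forall>i j. i \<noteq> j \<longrightarrow> q $ i \<noteq> q $ j) \<and>
     (\<exists>I0>0. constrained_critical_point (U_pot m) (I_mom m) I0 q)"

definition quad :: "real \<Rightarrow> real \<Rightarrow> real \<Rightarrow> real \<Rightarrow> (real^2)^4" where
  "quad a b c \<theta> = vector
     [vector [1, 0], vector [a * cos \<theta>, a * sin \<theta>],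
      vector [- b, 0], vector [- c * cos \<theta>, - c * sin \<theta>]]"

lemma quad_nth [simp]:
  "quad a b c \<theta> $ 1 = vector [1, 0]"
  "quad a b c \<theta> $ 2 = vector [a * cos \<theta>, a * sin \<theta>]"
  "quad a b c \<theta> $ 3 = vector [- b, 0]"
  "quad a b c \<theta> $ 4 = vector [- c * cos \<theta>, - c * sin \<theta>]"
  by (simp_all add: quad_def vector_def)

abbreviation side :: "real \<Rightarrow> real \<Rightarrow> real \<Rightarrow> real \<Rightarrow> 4 \<Rightarrow> 4 \<Rightarrow> real" where
  "side a b c \<theta> i j \<equiv> rdist (quad a b c \<theta>) i j"

lemma norm_diff_vector_2_squared:
  "(norm (vector [x, y] - vector [u, v] :: real^2))\<^sup>2 = (x - u)\<^sup>2 + (y - v)\<^sup>2"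
  by (simp add: norm_vec_def L2_set_def sum_2)

lemma side_squared:
  "(side a b c \<theta> 1 2)\<^sup>2 = a\<^sup>2 - 2 * a * cos \<theta> + 1"
  "(side a b c \<theta> 2 3)\<^sup>2 = a\<^sup>2 + 2 * a * b * cos \<theta> + b\<^sup>2"
  "(side a b c \<theta> 1 4)\<^sup>2 = c\<^sup>2 + 2 * c * cos \<theta> + 1"
  "(side a b c \<theta> 3 4)\<^sup>2 = b\<^sup>2 - 2 * b * c * cos \<theta> + c\<^sup>2"
  "(side a b c \<theta> 1 3)\<^sup>2 = (b + 1)\<^sup>2"
  "(side a b c \<theta> 2 4)\<^sup>2 = (a + c)\<^sup>2"
proof -
  have *: "(sin \<theta>)\<^sup>2 = 1 - (cos \<theta>)\<^sup>2" by (rule sin_squared_eq)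
  show "(side a b c \<theta> 1 2)\<^sup>2 = a\<^sup>2 - 2 * a * cos \<theta> + 1"
    unfolding rdist_def quad_nth norm_diff_vector_2_squared using * by algebra
  show "(side a b c \<theta> 2 3)\<^sup>2 = a\<^sup>2 + 2 * a * b * cos \<theta> + b\<^sup>2"
    unfolding rdist_def quad_nth norm_diff_vector_2_squared using * by algebra
  show "(side a b c \<theta> 1 4)\<^sup>2 = c\<^sup>2 + 2 * c * cos \<theta> + 1"
    unfolding rdist_def quad_nth norm_diff_vector_2_squared using * by algebra
  show "(side a b c \<theta> 3 4)\<^sup>2 = b\<^sup>2 - 2 * b * c * cos \<theta> + c\<^sup>2"
    unfolding rdist_def quad_nth norm_diff_vector_2_squared using * by algebra
  show "(side a b c \<theta> 1 3)\<^sup>2 = (b + 1)\<^sup>2"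
    unfolding rdist_def quad_nth norm_diff_vector_2_squared by (simp add: add.commute)
  show "(side a b c \<theta> 2 4)\<^sup>2 = (a + c)\<^sup>2"
    unfolding rdist_def quad_nth norm_diff_vector_2_squared using * by algebra
qed

definition normalized_convex_cc :: "real \<times> real \<times> real \<times> real \<Rightarrow> bool" where
  "normalized_convex_cc = (\<lambda>(a, b, c, \<theta>).
     0 < a \<and> 0 < b \<and> 0 < c \<and> 0 < \<theta> \<and> \<theta> < pi \<and>
     side a b c \<theta> 1 4 \<le> side a b c \<theta> 1 2 \<and>
     side a b c \<theta> 2 3 \<le> side a b c \<theta> 1 2 \<and>
     side a b c \<theta> 3 4 \<le> side a b c \<theta> 1 2 \<and>
     (\<exists>m. (\<forall>i. 0 < m i) \<and> central_configuration m (quad a b c \<theta>)))"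

definition C_set :: "(real \<times> real \<times> real \<times> real) set" where
  "C_set = {(a, b, c, \<theta>).
     0 < a \<and> 0 < b \<and> 0 < c \<and> 0 < \<theta> \<and> \<theta> < pi \<and>
     side a b c \<theta> 1 3 > side a b c \<theta> 1 2 \<and>
     side a b c \<theta> 2 4 > side a b c \<theta> 1 2 \<and>
     side a b c \<theta> 1 2 \<ge> side a b c \<theta> 1 4 \<and> side a b c \<theta> 1 4 \<ge> side a b c \<theta> 3 4 \<and>
     side a b c \<theta> 1 2 \<ge> side a b c \<theta> 2 3 \<and> side a b c \<theta> 2 3 \<ge> side a b c \<theta> 3 4}"

definition F_fun :: "real \<times> real \<times> real \<times> real \<Rightarrow> real" where
  "F_fun = (\<lambda>(a, b, c, \<theta>). let r = side a b c \<theta> in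
     ((r 2 4)^3 - (r 1 4)^3) * ((r 1 3)^3 - (r 1 2)^3) * ((r 2 3)^3 - (r 3 4)^3)
     - ((r 1 2)^3 - (r 1 4)^3) * ((r 2 4)^3 - (r 3 4)^3) * ((r 1 3)^3 - (r 2 3)^3))"

definition E_set :: "(real \<times> real \<times> real \<times> real) set" where
  "E_set = {s \<in> C_set. F_fun s = 0}"

definition D1_set :: "(real \<times> real \<times> real) set" where
  "D1_set = {(a, b, c). 0 < a \<and> 0 < b \<and> 0 < c \<and> c \<le> a \<and> a \<le> 1 \<and> b \<le> 1 \<and>
     1 / 2 * (- a + sqrt (4 - 3 * a\<^sup>2)) < c \<and> c < 1 / a * (b\<^sup>2 + 2 * b) \<and>
     c > - a + sqrt (a\<^sup>2 + b)}"

definition D2_set :: "(real \<times> real \<times> real) set" where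
  "D2_set = {(a, b, c). 0 < a \<and> 0 < b \<and> 0 < c \<and> c \<le> a \<and> a > 1 \<and> b \<le> 1 \<and>
     c < 1 / a * (b\<^sup>2 + 2 * b) \<and> b > 1 / 2 * (- 1 + sqrt (4 * a\<^sup>2 - 3)) \<and>
     c > - a + sqrt (a\<^sup>2 + b)}"

definition D_set :: "(real \<times> real \<times> real) set" where
  "D_set = D1_set \<union> D2_set"

end

theory Submission
  imports Defs
begin

text \<open>
  With \<open>u\<^sub>i\<^sub>j = r\<^sub>i\<^sub>j\<^sup>-\<^sup>3\<close>, a convex quadrilateral is a central configuration for some positive
  masses iff there is a multiplier \<open>l\<close>, below \<open>u\<close> on the exterior sides and above \<open>u\<close> on the
  diagonals, at which the three products of \<open>u\<^sub>i\<^sub>j - l\<close> over opposite pairs of edges agree. Equating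
  the products for two opposite sides and for the diagonals determines \<open>l\<close>; the pairs
  \<open>12, 34\<close> and \<open>14, 23\<close> must give the same value, and this is \<open>F = 0\<close>. For fixed \<open>(a, b, c)\<close> the
  squared distances are affine in \<open>t = cos \<theta>\<close>; the first value increases and the second decreases
  in \<open>t\<close>, with nonvanishing derivative, which gives uniqueness and differentiability of the root.
  The constraints of \<open>C\<close> confine \<open>t\<close> to an interval that is nonempty exactly when \<open>(a, b, c)\<close> lies
  in \<open>D\<close>, and at its ends \<open>F\<close> factors and has opposite signs.
\<close>

section \<open>Central configurations by a Lagrange multiplier\<close>

lemma pairs_4: "{(i::4, j). i < j} = {(4,1),(4,2),(4,3),(1,2),(1,3),(2,3)}"
proof -
  have "(i < j) = ((i,j) \<in> {(4,1),(4,2),(4,3),(1,2),(1,3),(2,3)})" for i j :: 4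
    using exhaust_4[of i] exhaust_4[of j] by (elim disjE) (simp_all add: less_bit0_def bit0.Rep_numeral bit0.Rep_1 bit0.Rep_0)
  then show ?thesis by auto
qed

lemma sum_pairs_4:
  "(\<Sum>(i, j) \<in> {(i::4, j). i < j}. g i j) = g 4 1 + g 4 2 + g 4 3 + g 1 2 + g 1 3 + (g 2 3 :: real)"
  unfolding pairs_4 by (simp add: algebra_simps)

lemma norm_has_real_derivative:
  fixes \<gamma> :: "real \<Rightarrow> 'a::real_inner"
  assumes "(\<gamma> has_vector_derivative v) (at t)" "\<gamma> t \<noteq> 0"
  shows "((\<lambda>s. norm (\<gamma> s)) has_real_derivative (\<gamma> t \<bullet> v) / norm (\<gamma> t)) (at t)"
proof -
  have "((\<lambda>s. norm (\<gamma> s)) has_derivative (\<lambda>h. (h *\<^sub>R v) \<bullet> sgn (\<gamma> t))) (at t)"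
    using has_derivative_compose[OF assms(1)[unfolded has_vector_derivative_def] has_derivative_norm[OF assms(2)]]
    by simp
  then show ?thesis
    unfolding has_field_derivative_def
    by (rule has_derivative_eq_rhs)
       (auto simp: fun_eq_iff sgn_div_norm inner_commute divide_inverse mult_ac)
qed

lemma rdist_has_real_derivative:
  assumes "(\<gamma> has_vector_derivative v) (at t)" "\<gamma> t $ i \<noteq> \<gamma> t $ j"
  shows "((\<lambda>s. rdist (\<gamma> s) i j) has_real_derivative
           ((\<gamma> t $ i - \<gamma> t $ j) \<bullet> (v $ i - v $ j)) / rdist (\<gamma> t) i j) (at t)"
  unfolding rdist_def using assms
  by (intro norm_has_real_derivative has_vector_derivative_diff
        bounded_linear.has_vector_derivative[OF bounded_linear_vec_nth]) auto

lemma rdist_pos: "q $ i \<noteq> q $ j \<Longrightarrow> 0 < rdist q i j"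
  by (simp add: rdist_def)

lemma rdist_scaleR: "rdist (c *\<^sub>R q) i j = \<bar>c\<bar> * rdist q i j"
  by (simp add: rdist_def flip: scaleR_diff_right)

text \<open>Degree -1 here and degree 2 for \<open>I_mom\<close>: with these homogeneities a curve
  can be pushed back to a level set of \<open>I_mom\<close> by rescaling, with a known effect on
  \<open>U_pot\<close>.\<close>

lemma U_pot_scaleR: "U_pot m (c *\<^sub>R q) = U_pot m q / \<bar>c\<bar>"
  unfolding U_pot_def rdist_scaleR sum_divide_distrib split_def by (rule sum.cong) auto

lemma I_mom_scaleR: "I_mom m (c *\<^sub>R q) = c\<^sup>2 * I_mom m q"
  unfolding I_mom_def rdist_scaleR sum_distrib_left split_def by (rule sum.cong) (auto simp: power_mult_distrib)

lemma I_mom_nonneg: "(\<And>i. 0 < m i) \<Longrightarrow> 0 \<le> I_mom m q"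
  unfolding I_mom_def by (intro mult_nonneg_nonneg sum_nonneg divide_nonneg_nonneg) (auto simp: less_imp_le)

lemma sum_masses_pos: "(\<And>i. 0 < m i) \<Longrightarrow> 0 < (\<Sum>i\<in>(UNIV :: 4 set). m i :: real)"
  by (rule sum_pos) auto

lemma I_mom_pos:
  assumes "\<And>i. 0 < m i" "\<And>i j. i \<noteq> j \<Longrightarrow> q $ i \<noteq> q $ j"
  shows "0 < I_mom m q"
proof -
  have *: "0 < m i * m j * (rdist q i j)\<^sup>2" if "i \<noteq> j" for i j
    using assms(1)[of i] assms(1)[of j] rdist_pos[OF assms(2)[OF that]] by simp
  have "0 < (\<Sum>(i, j) \<in> {(i, j). i < j}. m i * m j * (rdist q i j)\<^sup>2)"
    unfolding sum_pairs_4 by (intro add_pos_pos *) auto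
  then show ?thesis
    unfolding I_mom_def using sum_masses_pos[of m] assms(1) by simp
qed

lemma U_pot_has_real_derivative:
  assumes "(\<gamma> has_vector_derivative v) (at t)" "\<And>i j. i \<noteq> j \<Longrightarrow> \<gamma> t $ i \<noteq> \<gamma> t $ j"
  shows "((\<lambda>s. U_pot m (\<gamma> s)) has_real_derivative
           - (\<Sum>(i, j) \<in> {(i, j). i < j}. m i * m j / rdist (\<gamma> t) i j ^ 3 *
                ((\<gamma> t $ i - \<gamma> t $ j) \<bullet> (v $ i - v $ j)))) (at t)"
proof -
  have "((\<lambda>s. m i * m j / rdist (\<gamma> s) i j) has_real_derivative
           - (m i * m j / rdist (\<gamma> t) i j ^ 3 *
                ((\<gamma> t $ i - \<gamma> t $ j) \<bullet> (v $ i - v $ j)))) (at t)" if "i < j" for i j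
  proof -
    have ne: "\<gamma> t $ i \<noteq> \<gamma> t $ j" using assms(2) that by auto
    show ?thesis
      by (rule derivative_eq_intros rdist_has_real_derivative[OF assms(1) ne] refl)+
         (use rdist_pos[OF ne] in \<open>auto simp: power3_eq_cube\<close>)
  qed
  then show ?thesis
    unfolding U_pot_def sum_negf[symmetric] split_def by (intro DERIV_sum) auto
qed

lemma I_mom_has_real_derivative:
  assumes "(\<gamma> has_vector_derivative v) (at t)" "\<And>i j. i \<noteq> j \<Longrightarrow> \<gamma> t $ i \<noteq> \<gamma> t $ j"
  shows "((\<lambda>s. I_mom m (\<gamma> s)) has_real_derivative
           2 / (\<Sum>i\<in>UNIV. m i) * (\<Sum>(i, j) \<in> {(i, j). i < j}. m i * m j *
                ((\<gamma> t $ i - \<gamma> t $ j) \<bullet> (v $ i - v $ j)))) (at t)"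
proof -
  have *: "((\<lambda>s. m i * m j * (rdist (\<gamma> s) i j)\<^sup>2) has_real_derivative
           2 * (m i * m j * ((\<gamma> t $ i - \<gamma> t $ j) \<bullet> (v $ i - v $ j)))) (at t)" if "i < j" for i j
  proof -
    have ne: "\<gamma> t $ i \<noteq> \<gamma> t $ j" using assms(2) that by auto
    show ?thesis
      by (rule derivative_eq_intros rdist_has_real_derivative[OF assms(1) ne] refl)+
         (use rdist_pos[OF ne] in auto)
  qed
  have "((\<lambda>s. \<Sum>(i, j) \<in> {(i, j). i < j}. m i * m j * (rdist (\<gamma> s) i j)\<^sup>2) has_real_derivative
      (\<Sum>(i, j) \<in> {(i, j). i < j}. 2 * (m i * m j * ((\<gamma> t $ i - \<gamma> t $ j) \<bullet> (v $ i - v $ j))))) (at t)"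
    unfolding split_def using * by (intro DERIV_sum) auto
  from DERIV_cmult[OF this, of "1 / (\<Sum>i\<in>UNIV. m i)"] show ?thesis
    unfolding I_mom_def by (simp add: sum_distrib_left split_def)
qed

text \<open>Lagrange's multiplier rule. \<open>A v\<close> is minus the derivative of
  \<open>U_pot\<close> in direction \<open>v\<close>, and \<open>B v\<close> is that of
  \<open>I_mom\<close> up to a positive factor. A curve in the level set has \<open>B v = 0\<close>,
  so \<open>A v = l * B v\<close> makes \<open>U_pot\<close> stationary along it. Conversely,
  straight lines through \<open>q\<close> are rescaled into the level set, so that every direction
  \<open>v\<close> can be tested.\<close>

lemma central_configuration_iff:
  "central_configuration m q \<longleftrightarrow>
     (\<forall>i. 0 < m i) \<and> (\<forall>i j. i \<noteq> j \<longrightarrow> q $ i \<noteq> q $ j) \<and>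
     (\<exists>l. \<forall>v :: (real^2)^4. (\<Sum>(i, j) \<in> {(i, j). i < j}. m i * m j * (1 / rdist q i j ^ 3 - l) *
        ((q $ i - q $ j) \<bullet> (v $ i - v $ j))) = 0)"
    (is "_ \<longleftrightarrow> ?m \<and> ?d \<and> ?L")
proof -
  have *: "(\<exists>I0>0. constrained_critical_point (U_pot m) (I_mom m) I0 q) \<longleftrightarrow> ?L" if m: ?m and d: ?d
  proof -
    define A where "A v = (\<Sum>(i, j) \<in> {(i, j). i < j}. m i * m j / rdist q i j ^ 3 *
        ((q $ i - q $ j) \<bullet> (v $ i - v $ j)))" for v :: "(real^2)^4"
    define B where "B v = (\<Sum>(i, j) \<in> {(i, j). i < j}. m i * m j *
        ((q $ i - q $ j) \<bullet> (v $ i - v $ j)))" for v :: "(real^2)^4"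
    define M where "M = (\<Sum>i\<in>UNIV. m i)"
    have M: "0 < M" unfolding M_def by (rule sum_masses_pos) (use m in auto)
    have U': "((\<lambda>s. U_pot m (\<gamma> s)) has_real_derivative - A v) (at 0)"
      and I': "((\<lambda>s. I_mom m (\<gamma> s)) has_real_derivative 2 / M * B v) (at 0)"
      if "(\<gamma> has_vector_derivative v) (at 0)" "\<gamma> 0 = q" for \<gamma> v
      using U_pot_has_real_derivative[OF that(1), of m] I_mom_has_real_derivative[OF that(1), of m] d
      unfolding that(2) A_def B_def M_def by blast+
    have eq: "(\<Sum>(i, j) \<in> {(i, j). i < j}. m i * m j * (1 / rdist q i j ^ 3 - l) *
        ((q $ i - q $ j) \<bullet> (v $ i - v $ j))) = A v - l * B v" for l v
      unfolding A_def B_def sum_distrib_left sum_subtractf[symmetric]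
      by (rule sum.cong) (auto simp: algebra_simps)
    show ?thesis unfolding eq
    proof
      assume "\<exists>I0>0. constrained_critical_point (U_pot m) (I_mom m) I0 q"
      then obtain I0 where I0: "0 < I0" "I_mom m q = I0"
        and crit: "\<And>\<gamma> :: real \<Rightarrow> (real^2)^4. \<lbrakk>\<gamma> 0 = q; \<gamma> differentiable (at 0); \<forall>\<^sub>F t in nhds 0. I_mom m (\<gamma> t) = I0\<rbrakk>
          \<Longrightarrow> ((\<lambda>t. U_pot m (\<gamma> t)) has_real_derivative 0) (at 0)"
        unfolding constrained_critical_point_def by blast
      \<comment> \<open>The multiplier is read off from the derivative of
        \<open>U_pot m (\<eta> t) * sqrt (J t / I0)\<close> at 0, where the square root contributes
        \<open>B v / (M * I0)\<close>.\<close>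
      have "A v - U_pot m q / (M * I0) * B v = 0" for v
      proof -
        define \<eta> where "\<eta> s = q + s *\<^sub>R v" for s
        have \<eta>: "(\<eta> has_vector_derivative v) (at 0)" "\<eta> 0 = q"
          unfolding \<eta>_def by (auto intro!: derivative_eq_intros)
        define J where "J s = I_mom m (\<eta> s)" for s
        have J: "(J has_real_derivative 2 / M * B v) (at 0)" "J 0 = I0"
          using I'[OF \<eta>] I0(2) \<eta>(2) by (simp_all add: J_def[abs_def])
        text \<open>Rescaling the straight line \<open>\<eta>\<close> brings it back to the level set.\<close>
        define \<gamma> where "\<gamma> s = sqrt (I0 / J s) *\<^sub>R \<eta> s" for s
        have Jnn: "0 \<le> J s" for s unfolding J_def by (rule I_mom_nonneg) (use m in auto)
        have "J \<midarrow>0\<rightarrow> J 0" using J(1) DERIV_isCont isCont_def by blast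
        then have "\<forall>\<^sub>F s in at 0. 0 < J s"
          using I0(1) J(2) by (intro order_tendstoD) auto
        then have Jpos: "\<forall>\<^sub>F s in nhds 0. 0 < J s"
          using I0(1) J(2) by (auto simp: eventually_at_filter elim: eventually_mono)
        have "\<forall>\<^sub>F s in nhds 0. I_mom m (\<gamma> s) = I0"
          using Jpos by eventually_elim
            (use I0(1) in \<open>simp add: \<gamma>_def I_mom_scaleR flip: J_def\<close>)
        moreover have "\<gamma> 0 = q" using I0(1) \<eta>(2) J(2) by (simp add: \<gamma>_def)
        moreover have "\<gamma> differentiable (at 0)"
        proof -
          have "((\<lambda>s. I0 / J s) has_real_derivative - (I0 * (2 / M * B v)) / (J 0 * J 0)) (at 0)"
            by (rule derivative_eq_intros J refl)+ (use I0(1) J(2) in auto)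
          from DERIV_chain2[OF DERIV_real_sqrt this] have
            "((\<lambda>s. sqrt (I0 / J s)) has_real_derivative
                (inverse (sqrt (I0 / J 0)) / 2) * (- (I0 * (2 / M * B v)) / (J 0 * J 0))) (at 0)"
            using I0(1) J(2) by simp
          from has_vector_derivative_scaleR[OF this \<eta>(1)] show ?thesis
            unfolding \<gamma>_def by (auto simp: differentiable_def has_vector_derivative_def)
        qed
        ultimately have "((\<lambda>t. U_pot m (\<gamma> t)) has_real_derivative 0) (at 0)"
          by (intro crit)
        moreover have "U_pot m (\<gamma> t) = U_pot m (\<eta> t) * sqrt (J t / I0)" for t
          using I0(1) Jnn[of t] by (simp add: \<gamma>_def U_pot_scaleR real_sqrt_divide)
        ultimately have 0: "((\<lambda>t. U_pot m (\<eta> t) * sqrt (J t / I0)) has_real_derivative 0) (at 0)"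
          by simp
        from DERIV_cdivide[OF J(1), of I0] have "((\<lambda>t. sqrt (J t / I0)) has_real_derivative
              inverse (sqrt (J 0 / I0)) / 2 * (2 / M * B v / I0)) (at 0)"
            by (intro DERIV_chain2[OF DERIV_real_sqrt]) (use I0(1) J(2) in auto)
        from DERIV_mult[OF U'[OF \<eta>] this]
        have "((\<lambda>t. U_pot m (\<eta> t) * sqrt (J t / I0)) has_real_derivative
              - A v + U_pot m q * (B v / (M * I0))) (at 0)"
          using I0(1) J(2) \<eta>(2) by (simp add: algebra_simps)
        from DERIV_unique[OF this 0] show ?thesis by (simp add: algebra_simps)
      qed
      then show "\<exists>l. \<forall>v. A v - l * B v = 0" by blast
    next
      assume "\<exists>l. \<forall>v. A v - l * B v = 0"
      then obtain l where l: "\<And>v. A v = l * B v" by auto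
      have "((\<lambda>t. U_pot m (\<gamma> t)) has_real_derivative 0) (at 0)"
        if \<gamma>: "\<gamma> 0 = q" "\<gamma> differentiable (at 0)" "\<forall>\<^sub>F t in nhds 0. I_mom m (\<gamma> t) = I_mom m q" for \<gamma>
      proof -
        obtain v where v: "(\<gamma> has_vector_derivative v) (at 0)"
          using \<gamma>(2) vector_derivative_works by blast
        have "((\<lambda>t. I_mom m (\<gamma> t)) has_real_derivative 0) (at 0)"
          using DERIV_cong_ev[OF refl \<gamma>(3) refl, of 0] by simp
        from DERIV_unique[OF I'[OF v \<gamma>(1)] this] have "B v = 0" using M by simp
        then show ?thesis using U'[OF v \<gamma>(1)] l[of v] by simp
      qed
      moreover have "0 < I_mom m q" using I_mom_pos m d by blast
      ultimately show "\<exists>I0>0. constrained_critical_point (U_pot m) (I_mom m) I0 q"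
        unfolding constrained_critical_point_def by (intro exI[of _ "I_mom m q"]) auto
    qed
  qed
  show ?thesis unfolding central_configuration_def by (rule conj_cong[OF refl], rule conj_cong[OF refl], rule *)
qed

section \<open>Equilibrium stresses of the quadrilateral\<close>

lemma vector_4_nth [simp]:
  "vector [x, y, z, u] $ (1::4) = (x::'a::zero)" "vector [x, y, z, u] $ (2::4) = y"
  "vector [x, y, z, u] $ (3::4) = z" "vector [x, y, z, u] $ (4::4) = u"
  by (simp_all add: vector_def)

text \<open>The weights form an equilibrium stress on the six edges between the four points. Such a
  stress is unique up to a factor, and the five linear equations cut out this line. Since
  \<open>4\<close> is the least index, the edges at body 4 appear as \<open>w 4 1\<close>,
  \<open>w 4 2\<close>, \<open>w 4 3\<close>.\<close>

lemma quad_balance_iff: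
  fixes a b c \<theta> :: real
  assumes "0 < a" "0 < b" "0 < c" "0 < \<theta>" "\<theta> < pi"
  defines "q \<equiv> quad a b c \<theta>"
  shows "(\<forall>v :: (real^2)^4. (\<Sum>(i, j) \<in> {(i, j). i < j}. w i j * ((q $ i - q $ j) \<bullet> (v $ i - v $ j))) = 0) \<longleftrightarrow>
     c * w 4 1 = a * w 1 2 \<and> w 1 2 + w 4 1 + (1 + b) * w 1 3 = 0 \<and> b * w 2 3 = w 1 2 \<and>
     a * (w 1 2 + w 2 3) + (a + c) * w 4 2 = 0 \<and> c * w 4 3 = a * w 2 3"
    (is "(\<forall>v. ?S v = 0) \<longleftrightarrow> ?R")
proof
  have s: "0 < sin \<theta>" using assms by (simp add: sin_gt_zero)
  assume 0: "\<forall>v. ?S v = 0"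
  \<comment> \<open>Each test displacement moves a single body orthogonally to one diagonal:
    \<open>[sin \<theta>, - cos \<theta>]\<close> is orthogonal to the diagonal through bodies 2 and
    4, \<open>[0, 1]\<close> to the one through 1 and 3. Every remaining inner product carries the
    factor \<open>sin \<theta>\<close>.\<close>
  have "sin \<theta> * (w 1 2 + w 4 1 + (1 + b) * w 1 3) = 0"
    using 0[rule_format, of "vector [vector [sin \<theta>, - cos \<theta>], 0, 0, 0]"]
    unfolding sum_pairs_4 q_def by (simp add: inner_vec_def sum_2 algebra_simps)
  moreover have "sin \<theta> * (c * w 4 1 - a * w 1 2) = 0"
    using 0[rule_format, of "vector [vector [0, 1], 0, 0, 0]"]
    unfolding sum_pairs_4 q_def by (simp add: inner_vec_def sum_2 algebra_simps)
  moreover have "sin \<theta> * (b * w 2 3 - w 1 2) = 0"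
    using 0[rule_format, of "vector [0, vector [sin \<theta>, - cos \<theta>], 0, 0]"]
    unfolding sum_pairs_4 q_def by (simp add: inner_vec_def sum_2 algebra_simps)
  moreover have "sin \<theta> * (a * (w 1 2 + w 2 3) + (a + c) * w 4 2) = 0"
    using 0[rule_format, of "vector [0, vector [0, 1], 0, 0]"]
    unfolding sum_pairs_4 q_def by (simp add: inner_vec_def sum_2 algebra_simps)
  moreover have "sin \<theta> * (c * w 4 3 - a * w 2 3) = 0"
    using 0[rule_format, of "vector [0, 0, vector [0, 1], 0]"]
    unfolding sum_pairs_4 q_def by (simp add: inner_vec_def sum_2 algebra_simps)
  ultimately show ?R using s by simp
next
  assume R: ?R
  \<comment> \<open>The free factor of the stress, normalized so that the weights of all exterior
    sides are polynomial in \<open>a\<close>, \<open>b\<close>, \<open>c\<close>.\<close>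
  define k where "k = w 2 3 / c"
  have k: "w 2 3 = c * k" using assms by (simp add: k_def)
  have w12: "w 1 2 = b * c * k" using R k by simp
  have "c * w 4 1 = c * (a * b * k)" "c * w 4 3 = c * (a * k)"
    using R unfolding w12 k by (auto simp: mult.assoc)
  then have w: "w 4 1 = a * b * k" "w 4 3 = a * k" using assms by simp_all
  show "\<forall>v. ?S v = 0"
  proof
    fix v
    have "w 4 2 * (a + c) = - (a * c * (1 + b) * k)" "w 1 3 * (1 + b) = - (b * (a + c) * k)"
      using R unfolding w12 w k by (auto simp: algebra_simps)
    then show "?S v = 0"
      unfolding sum_pairs_4 q_def w w12 k
      by (simp add: inner_vec_def sum_2) algebra
  qed
qed

section \<open>Distances in the quadrilateral\<close>

lemma quad_distinct:
  assumes "0 < a" "0 < b" "0 < c" "0 < \<theta>" "\<theta> < pi" "i \<noteq> j"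
  shows "quad a b c \<theta> $ i \<noteq> quad a b c \<theta> $ j"
proof -
  have "0 < sin \<theta>" using assms by (simp add: sin_gt_zero)
  then have "0 < a * sin \<theta>" "0 < c * sin \<theta>" using assms by auto
  then show ?thesis
    using exhaust_4[of i] exhaust_4[of j] assms(1-3,6)
    by (elim disjE) (auto simp: vec_eq_iff forall_2)
qed

lemma side_pos:
  assumes "0 < a" "0 < b" "0 < c" "0 < \<theta>" "\<theta> < pi" "i \<noteq> j"
  shows "0 < side a b c \<theta> i j"
  by (rule rdist_pos[OF quad_distinct[OF assms]])

lemma rdist_commute: "rdist q i j = rdist q j i"
  by (simp add: rdist_def norm_minus_commute)

lemma cos_bounds:
  assumes "0 < \<theta>" "\<theta> < pi"
  shows "-1 < cos \<theta>" "cos \<theta> < 1"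
  using cos_monotone_0_pi[of 0 \<theta>] cos_monotone_0_pi[of \<theta> pi] assms by auto

lemma side_diagonals:
  assumes "0 < a" "0 < b" "0 < c"
  shows "side a b c \<theta> 1 3 = b + 1" "side a b c \<theta> 2 4 = a + c"
  using side_squared(5,6)[of a b c \<theta>] assms
  by (simp_all add: power2_eq_iff_nonneg rdist_def)

text \<open>The triangle inequality in the two triangles spanned by the origin with the sides 12 and
  34. It decides the sign of the stress of a central configuration.\<close>

lemma opposite_sides_less_diagonals:
  assumes "0 < a" "0 < b" "0 < c" "0 < \<theta>" "\<theta> < pi"
  shows "side a b c \<theta> 1 2 + side a b c \<theta> 3 4 < side a b c \<theta> 1 3 + side a b c \<theta> 2 4"
proof -
  have t: "-1 < cos \<theta>" using cos_bounds assms by blast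
  have "(side a b c \<theta> 1 2)\<^sup>2 < (1 + a)\<^sup>2"
    unfolding side_squared using mult_strict_left_mono[OF t assms(1)] by (simp add: power2_eq_square algebra_simps)
  moreover have "(side a b c \<theta> 3 4)\<^sup>2 < (b + c)\<^sup>2"
    unfolding side_squared using mult_strict_left_mono[OF t, of "b * c"] assms
    by (simp add: power2_eq_square algebra_simps)
  ultimately have "side a b c \<theta> 1 2 < 1 + a" "side a b c \<theta> 3 4 < b + c"
    using assms by (auto intro: power2_less_imp_less)
  then show ?thesis using side_diagonals assms by simp
qed

section \<open>Existence of positive masses\<close>

lemma inverse_cube_less_iff:
  fixes x y :: real
  assumes "0 < x" "0 < y"
  shows "1 / x ^ 3 < 1 / y ^ 3 \<longleftrightarrow> y < x"
  using assms power_mono_iff[of x y 3] by (simp add: field_simps flip: not_le)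

lemma inverse_cube_le_iff:
  fixes x y :: real
  assumes "0 < x" "0 < y"
  shows "1 / x ^ 3 \<le> 1 / y ^ 3 \<longleftrightarrow> y \<le> x"
  using assms by (simp add: field_simps power_mono_iff)

text \<open>Six equations in four unknowns. Those at body 1 express \<open>x2\<close>,
  \<open>x3\<close>, \<open>x4\<close> by \<open>x1\<close>, the edge 23 fixes \<open>x1\<close>,
  and the two product conditions make the edges 24 and 34 consistent.\<close>

lemma rank_one_weights:
  fixes s12 s13 s14 s23 s24 s34 :: real
  assumes "0 < s12" "0 < s14" "0 < s23" "0 < s34" "s13 < 0" "s24 < 0"
    and "s12 * s34 = s14 * s23" "s12 * s34 = s13 * s24"
  obtains x1 x2 x3 x4 where "0 < x1" "0 < x2" "0 < x3" "0 < x4"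
    "x1 * x2 * s12 = 1" "x1 * x4 * s14 = 1" "x2 * x3 * s23 = 1" "x3 * x4 * s34 = 1"
    "x1 * x3 * s13 = -1" "x2 * x4 * s24 = -1"
proof -
  \<comment> \<open>Multiplying the equations for 12 and 13 and dividing by the one for 23 gives
    \<open>x1 * x1 * s12 * s13 = - s23\<close>.\<close>
  define x1 where "x1 = sqrt (s23 / (s12 * - s13))"
  have pos: "0 < s23 / (s12 * - s13)" using assms by (simp add: divide_less_0_iff mult_less_0_iff)
  then have x1: "0 < x1" "x1 * x1 = s23 / (s12 * - s13)"
    unfolding x1_def by (simp, metis abs_of_pos real_sqrt_mult_self)
  then have sq: "x1 * x1 * s12 * s13 = - s23"
    using assms by (simp add: field_simps)
  define x2 x3 x4 where "x2 = 1 / (x1 * s12)" and "x3 = - 1 / (x1 * s13)" and "x4 = 1 / (x1 * s14)"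
  have e: "x1 * x2 * s12 = 1" "x1 * x4 * s14 = 1" "x1 * x3 * s13 = -1"
    using assms x1 by (simp_all add: x2_def x3_def x4_def)
  have p: "0 < x2" "0 < x3" "0 < x4"
    using assms x1(1) by (auto simp: x2_def x3_def x4_def zero_less_divide_iff mult_pos_neg)
  have "x2 * x3 * s23 * (x1 * x1 * s12 * s13) = - s23"
    using e by algebra
  then have 23: "x2 * x3 * s23 = 1" using sq assms by simp
  have "s24 * s13 = s14 * s23" using assms by (simp add: mult_ac)
  then have "x2 * x4 * s24 * (x1 * x1 * s13 * s12 * s14) = s14 * s23"
    using e by algebra
  then have "x2 * x4 * s24 * (s14 * s23) = -1 * (s14 * s23)"
    using sq by algebra
  then have 24: "x2 * x4 * s24 = -1" using assms by (simp only: mult_cancel_right) auto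
  have "x3 * x4 * s34 * (x1 * x1 * s12 * s13 * s14) = - (s14 * s23)"
    using e assms(7) by algebra
  then have "x3 * x4 * s34 * (s14 * s23) = 1 * (s14 * s23)"
    using sq by algebra
  then have 34: "x3 * x4 * s34 = 1" using assms by (simp only: mult_cancel_right) auto
  show thesis by (rule that[OF x1(1) p e(1,2) 23 34 e(3) 24])
qed

text \<open>The pairs \<open>x, y\<close>, \<open>z, w\<close> and \<open>d, e\<close> belong to one
  involution of the line with centre \<open>l\<close>. In each equation the squares of
  \<open>l\<close> cancel, so \<open>l\<close> is the solution of two linear equations, and the
  right side states that these agree. Identities such as
  \<open>(x - l) * D = (x - d) * (x - e)\<close> then place \<open>l\<close> strictly between the
  two groups of values.\<close>

lemma involution_iff:
  fixes x y z w d e :: real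
  shows "(\<exists>l. l < x \<and> l < y \<and> l < z \<and> l < w \<and> d < l \<and> e < l \<and>
              (x - l) * (y - l) = (z - l) * (w - l) \<and> (x - l) * (y - l) = (d - l) * (e - l)) \<longleftrightarrow>
         d < x \<and> d < y \<and> d < z \<and> d < w \<and> e < x \<and> e < y \<and> e < z \<and> e < w \<and>
         (x * y - d * e) * (z + w - d - e) = (z * w - d * e) * (x + y - d - e)" (is "?L \<longleftrightarrow> ?R")
proof
  assume ?L
  then obtain l where l: "l < x" "l < y" "l < z" "l < w" "d < l" "e < l"
    and eq: "(x - l) * (y - l) = (z - l) * (w - l)" "(x - l) * (y - l) = (d - l) * (e - l)"
    by blast
  have "x * y - d * e = l * (x + y - d - e)" "z * w - d * e = l * (z + w - d - e)"
    using eq by algebra+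
  then show ?R using l by simp
next
  assume R: ?R
  define D where "D = x + y - d - e"
  have D: "0 < D" "0 < z + w - d - e" using R by (auto simp: D_def)
  define l where "l = (x * y - d * e) / D"
  have lD: "l * D = x * y - d * e" using D by (simp add: l_def)
  have "l * (z + w - d - e) * D = (z * w - d * e) * D"
    using R lD unfolding D_def by algebra
  then have lD': "l * (z + w - d - e) = z * w - d * e" using D by simp
  have "(x - l) * D = (x - d) * (x - e)" "(y - l) * D = (y - d) * (y - e)"
    "(l - d) * D = (x - d) * (y - d)" "(l - e) * D = (x - e) * (y - e)"
    using lD unfolding D_def by algebra+
  moreover have "(z - l) * (z + w - d - e) = (z - d) * (z - e)" "(w - l) * (z + w - d - e) = (w - d) * (w - e)"
    using lD' by algebra+
  ultimately have "0 < (x - l) * D" "0 < (y - l) * D" "0 < (l - d) * D" "0 < (l - e) * D"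
     "0 < (z - l) * (z + w - d - e)" "0 < (w - l) * (z + w - d - e)"
    using R by simp_all
  then have "l < x" "l < y" "d < l" "e < l" "l < z" "l < w"
    using D by (simp_all add: zero_less_mult_iff)
  moreover have "(x - l) * (y - l) = (d - l) * (e - l)" "(z - l) * (w - l) = (d - l) * (e - l)"
    using lD lD' unfolding D_def by algebra+
  ultimately show ?L by auto
qed

text \<open>These are Dziobek's relations. The weights \<open>m i * m j * s l i j\<close> form a
  stress, whose products over opposite pairs of edges all equal \<open>a * b * c * k * k\<close>;
  dividing by the product of the masses leaves the relations for \<open>s l\<close>. Conversely,
  \<open>rank_one_weights\<close> yields the masses.\<close>

lemma central_configuration_quad_iff:
  assumes pos: "0 < a" "0 < b" "0 < c" "0 < \<theta>" "\<theta> < pi"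
  defines "s \<equiv> \<lambda>l i j. 1 / side a b c \<theta> i j ^ 3 - l"
  shows "(\<exists>m. (\<forall>i. 0 < m i) \<and> central_configuration m (quad a b c \<theta>)) \<longleftrightarrow>
     (\<exists>l. 0 < s l 1 2 \<and> 0 < s l 3 4 \<and> 0 < s l 1 4 \<and> 0 < s l 2 3 \<and> s l 1 3 < 0 \<and> s l 2 4 < 0 \<and>
        s l 1 2 * s l 3 4 = s l 1 4 * s l 2 3 \<and> s l 1 2 * s l 3 4 = s l 1 3 * s l 2 4)"
    (is "?L \<longleftrightarrow> (\<exists>l. ?R l)")
proof -
  have sym: "s l i j = s l j i" for l i j unfolding s_def by (simp add: rdist_commute)
  show ?thesis
  proof
    assume ?L
    then obtain m l where m: "\<And>i. 0 < m i"
      and "\<forall>v :: (real^2)^4. (\<Sum>(i, j) \<in> {(i, j). i < j}. m i * m j * s l i j *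
          ((quad a b c \<theta> $ i - quad a b c \<theta> $ j) \<bullet> (v $ i - v $ j))) = 0"
      unfolding central_configuration_iff s_def by blast
    then have bal: "c * (m 4 * m 1 * s l 4 1) = a * (m 1 * m 2 * s l 1 2)"
      "m 1 * m 2 * s l 1 2 + m 4 * m 1 * s l 4 1 + (1 + b) * (m 1 * m 3 * s l 1 3) = 0"
      "b * (m 2 * m 3 * s l 2 3) = m 1 * m 2 * s l 1 2"
      "a * (m 1 * m 2 * s l 1 2 + m 2 * m 3 * s l 2 3) + (a + c) * (m 4 * m 2 * s l 4 2) = 0"
      "c * (m 4 * m 3 * s l 4 3) = a * (m 2 * m 3 * s l 2 3)"
      by (simp_all add: quad_balance_iff[OF pos])
    define k where "k = m 2 * m 3 * s l 2 3 / c"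
    have w23: "m 2 * m 3 * s l 2 3 = c * k" using pos by (simp add: k_def)
    have w12: "m 1 * m 2 * s l 1 2 = b * c * k" using bal(3) unfolding w23 by simp
    have "c * (m 4 * m 1 * s l 4 1) = c * (a * b * k)" "c * (m 4 * m 3 * s l 4 3) = c * (a * k)"
      using bal(1,5) unfolding w12 w23 by auto
    then have w14: "m 1 * m 4 * s l 1 4 = a * b * k" and w34: "m 3 * m 4 * s l 3 4 = a * k"
      using pos by (simp_all add: sym[of l 4] mult_ac)
    have "m 1 * m 3 * s l 1 3 * (1 + b) = - (b * (a + c)) * k"
      using bal(2) w14 unfolding w12 sym[of l 4] by algebra
    then have w13: "m 1 * m 3 * s l 1 3 = - (b * (a + c) / (1 + b)) * k"
      using pos by (simp add: field_simps)
    have "m 2 * m 4 * s l 2 4 * (a + c) = - (a * c * (1 + b)) * k"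
      using bal(4) unfolding w12 w23 sym[of l 4] by algebra
    then have w24: "m 2 * m 4 * s l 2 4 = - (a * c * (1 + b) / (a + c)) * k"
      using pos by (simp add: field_simps)
    have sgn_s: "0 < s l i j \<longleftrightarrow> 0 < m i * m j * s l i j" "s l i j < 0 \<longleftrightarrow> m i * m j * s l i j < 0" for i j
      using m[of i] m[of j] by (auto simp: zero_less_mult_iff mult_less_0_iff)
    \<comment> \<open>Otherwise 13 would be at most 12 and 24 at most 34, against
      \<open>opposite_sides_less_diagonals\<close>.\<close>
    have "0 < k"
    proof (rule ccontr)
      assume "\<not> 0 < k"
      then have "k \<le> 0" by simp
      then have "\<not> 0 < s l 1 2" "\<not> 0 < s l 3 4" "\<not> s l 1 3 < 0" "\<not> s l 2 4 < 0"
        unfolding sgn_s w12 w34 w13 w24 using pos by (simp_all add: not_less mult_le_0_iff divide_le_0_iff)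
      then have "1 / side a b c \<theta> 1 2 ^ 3 \<le> 1 / side a b c \<theta> 1 3 ^ 3"
        "1 / side a b c \<theta> 3 4 ^ 3 \<le> 1 / side a b c \<theta> 2 4 ^ 3"
        unfolding s_def by linarith+
      then have "side a b c \<theta> 1 3 \<le> side a b c \<theta> 1 2" "side a b c \<theta> 2 4 \<le> side a b c \<theta> 3 4"
        using side_pos[OF pos] by (simp_all add: inverse_cube_le_iff)
      then show False using opposite_sides_less_diagonals[OF pos] by linarith
    qed
    then have "0 < s l 1 2" "0 < s l 3 4" "0 < s l 1 4" "0 < s l 2 3" "s l 1 3 < 0" "s l 2 4 < 0"
      unfolding sgn_s w12 w34 w14 w23 w13 w24 using pos by simp_all
    moreover have M: "m 1 * m 2 * m 3 * m 4 \<noteq> 0" using m by (metis less_irrefl mult_eq_0_iff)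
    have "m 1 * m 2 * m 3 * m 4 * (s l 1 2 * s l 3 4) = m 1 * m 2 * m 3 * m 4 * (s l 1 4 * s l 2 3)"
      using w12 w34 w14 w23 by algebra
    then have "s l 1 2 * s l 3 4 = s l 1 4 * s l 2 3"
      using M by (simp only: mult_cancel_left) auto
    moreover have "(m 1 * m 3 * s l 1 3) * (m 2 * m 4 * s l 2 4) = a * b * c * k * k"
    proof -
      have "b * (a + c) / (1 + b) * (a * c * (1 + b) / (a + c)) = a * b * c"
        using pos by (simp add: divide_simps)
      then show ?thesis unfolding w13 w24 by algebra
    qed
    then have "m 1 * m 2 * m 3 * m 4 * (s l 1 2 * s l 3 4) = m 1 * m 2 * m 3 * m 4 * (s l 1 3 * s l 2 4)"
      using w12 w34 by algebra
    then have "s l 1 2 * s l 3 4 = s l 1 3 * s l 2 4"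
      using M by (simp only: mult_cancel_left) auto
    ultimately show "\<exists>l. ?R l" by blast
  next
    assume "\<exists>l. ?R l"
    then obtain l where R: "?R l" by blast
    obtain x1 x2 x3 x4 where x: "0 < x1" "0 < x2" "0 < x3" "0 < x4"
      and e: "x1 * x2 * s l 1 2 = 1" "x1 * x4 * s l 1 4 = 1" "x2 * x3 * s l 2 3 = 1" "x3 * x4 * s l 3 4 = 1"
      "x1 * x3 * s l 1 3 = -1" "x2 * x4 * s l 2 4 = -1"
      using R by (auto intro: rank_one_weights[of "s l 1 2" "s l 1 4" "s l 2 3" "s l 3 4" "s l 1 3" "s l 2 4"])
    text \<open>The balance equations fix the ratios of the products \<open>m\<^sub>i m\<^sub>j (u\<^sub>i\<^sub>j - l)\<close>; the masses are scaled so
      that the pairs \<open>12\<close>, \<open>14\<close>, \<open>23\<close>, \<open>34\<close> give \<open>b c\<close>, \<open>a b\<close>, \<open>c\<close>, \<open>a\<close>.\<close>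
    define p where "p = sqrt ((a + c) / (1 + b))"
    have p: "0 < p" "p * p * (1 + b) = a + c" using pos by (simp_all add: p_def)
    define m :: "4 \<Rightarrow> real" where "m i = vector [b * p * x1, c / p * x2, p * x3, a / p * x4] $ i" for i
    have m: "m 1 = b * p * x1" "m 2 = c / p * x2" "m 3 = p * x3" "m 4 = a / p * x4"
      by (simp_all add: m_def)
    have mpos: "0 < m i" for i
      using exhaust_4[of i] x p pos by (elim disjE) (simp_all add: m)
    have "m 1 * m 2 * s l 1 2 = b * c * (x1 * x2 * s l 1 2)" "m 1 * m 4 * s l 1 4 = a * b * (x1 * x4 * s l 1 4)"
      "m 2 * m 3 * s l 2 3 = c * (x2 * x3 * s l 2 3)" "m 3 * m 4 * s l 3 4 = a * (x3 * x4 * s l 3 4)"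
      "m 1 * m 3 * s l 1 3 = b * (p * p) * (x1 * x3 * s l 1 3)"
      "m 2 * m 4 * s l 2 4 = a * c / (p * p) * (x2 * x4 * s l 2 4)"
      using p(1) by (simp_all add: m)
    then have w: "m 1 * m 2 * s l 1 2 = b * c" "m 1 * m 4 * s l 1 4 = a * b" "m 2 * m 3 * s l 2 3 = c"
      "m 3 * m 4 * s l 3 4 = a" "m 1 * m 3 * s l 1 3 = - b * (p * p)" "m 2 * m 4 * s l 2 4 = - (a * c / (p * p))"
      unfolding e by simp_all
    have pp: "(a + c) / (p * p) = 1 + b" using p by (simp add: field_simps)
    have "c * (m 4 * m 1 * s l 4 1) = a * (m 1 * m 2 * s l 1 2) \<and>
      m 1 * m 2 * s l 1 2 + m 4 * m 1 * s l 4 1 + (1 + b) * (m 1 * m 3 * s l 1 3) = 0 \<and>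
      b * (m 2 * m 3 * s l 2 3) = m 1 * m 2 * s l 1 2 \<and>
      a * (m 1 * m 2 * s l 1 2 + m 2 * m 3 * s l 2 3) + (a + c) * (m 4 * m 2 * s l 4 2) = 0 \<and>
      c * (m 4 * m 3 * s l 4 3) = a * (m 2 * m 3 * s l 2 3)"
      unfolding sym[of l 4] mult.commute[of "m 4"] w
      using p(2) arg_cong[OF pp, of "\<lambda>x. a * c * x"] by (simp add: algebra_simps)
    then have "\<forall>v :: (real^2)^4. (\<Sum>(i, j) \<in> {(i, j). i < j}. m i * m j * s l i j *
          ((quad a b c \<theta> $ i - quad a b c \<theta> $ j) \<bullet> (v $ i - v $ j))) = 0"
      by (simp only: quad_balance_iff[OF pos])
    then have "central_configuration m (quad a b c \<theta>)"
      unfolding central_configuration_iff s_def using mpos quad_distinct[OF pos] by blast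
    then show ?L using mpos by blast
  qed
qed

section \<open>The equation \<open>F = 0\<close> and the set E\<close>

text \<open>The variables stand for the cubes of the distances. Dividing \<open>F\<close> by their
  product gives the difference of the two sides of the compatibility condition in
  \<open>involution_iff\<close>.\<close>

lemma F_eq_involution:
  fixes r12 r13 r14 r23 r24 r34 :: real
  assumes "0 < r12" "0 < r13" "0 < r14" "0 < r23" "0 < r24" "0 < r34"
  shows "(r24 - r14) * (r13 - r12) * (r23 - r34) - (r12 - r14) * (r24 - r34) * (r13 - r23) =
    r12 * r13 * r14 * r23 * r24 * r34 *
      ((1 / r12 * (1 / r34) - 1 / r13 * (1 / r24)) * (1 / r14 + 1 / r23 - 1 / r13 - 1 / r24)
       - (1 / r14 * (1 / r23) - 1 / r13 * (1 / r24)) * (1 / r12 + 1 / r34 - 1 / r13 - 1 / r24))"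
  using assms by (simp add: divide_simps) (simp add: algebra_simps)

lemma F_fun_eq_0_iff:
  assumes pos: "0 < a" "0 < b" "0 < c" "0 < \<theta>" "\<theta> < pi"
  defines "u \<equiv> \<lambda>i j. 1 / side a b c \<theta> i j ^ 3"
  shows "F_fun (a, b, c, \<theta>) = 0 \<longleftrightarrow>
     (u 1 2 * u 3 4 - u 1 3 * u 2 4) * (u 1 4 + u 2 3 - u 1 3 - u 2 4) =
     (u 1 4 * u 2 3 - u 1 3 * u 2 4) * (u 1 2 + u 3 4 - u 1 3 - u 2 4)"
proof -
  have p: "0 < side a b c \<theta> i j ^ 3" if "i \<noteq> j" for i j
    using side_pos[OF pos that] by simp
  have nz: "side a b c \<theta> i j \<noteq> 0" if "i \<noteq> j" for i j
    using side_pos[OF pos that] by simp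
  show ?thesis
    unfolding F_fun_def Let_def prod.case u_def
    by (subst F_eq_involution) (use p nz in simp_all)
qed

text \<open>Normalization only makes 12 the longest exterior side, while \<open>C_set\<close> also
  makes 34 the shortest. The latter follows from the relation
  \<open>(u 1 2 - l) * (u 3 4 - l) = (u 1 4 - l) * (u 2 3 - l)\<close>: since \<open>u 1 2\<close>
  is below \<open>u 1 4\<close> and \<open>u 2 3\<close>, the other factor must make up for it. With
  this order, comparing the diagonals to 12 compares them to all sides.\<close>

lemma normalized_convex_cc_iff_E_set: "normalized_convex_cc s \<longleftrightarrow> s \<in> E_set"
proof -
  obtain a b c \<theta> where s: "s = (a, b, c, \<theta>)" by (metis surj_pair)
  show ?thesis
  proof (cases "0 < a \<and> 0 < b \<and> 0 < c \<and> 0 < \<theta> \<and> \<theta> < pi")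
    case False
    then show ?thesis unfolding s normalized_convex_cc_def E_set_def C_set_def by auto
  next
    case True
    then have pos: "0 < a" "0 < b" "0 < c" "0 < \<theta>" "\<theta> < pi" by auto
    define u where "u i j = 1 / side a b c \<theta> i j ^ 3" for i j
    have less: "u i j < u k l \<longleftrightarrow> side a b c \<theta> k l < side a b c \<theta> i j"
      and le: "u i j \<le> u k l \<longleftrightarrow> side a b c \<theta> k l \<le> side a b c \<theta> i j" if "i \<noteq> j" "k \<noteq> l" for i j k l
      unfolding u_def using inverse_cube_less_iff inverse_cube_le_iff side_pos[OF pos] that by simp_all
    let ?P = "\<lambda>l. l < u 1 2 \<and> l < u 3 4 \<and> l < u 1 4 \<and> l < u 2 3 \<and> u 1 3 < l \<and> u 2 4 < l \<and>
      (u 1 2 - l) * (u 3 4 - l) = (u 1 4 - l) * (u 2 3 - l) \<and>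
      (u 1 2 - l) * (u 3 4 - l) = (u 1 3 - l) * (u 2 4 - l)"
    have cc: "(\<exists>m. (\<forall>i. 0 < m i) \<and> central_configuration m (quad a b c \<theta>)) \<longleftrightarrow> (\<exists>l. ?P l)"
      unfolding central_configuration_quad_iff[OF pos] u_def by simp
    have order: "u 1 4 \<le> u 3 4 \<and> u 2 3 \<le> u 3 4" if asm: "u 1 2 \<le> u 1 4" "u 1 2 \<le> u 2 3" "\<exists>l. ?P l"
    proof -
      obtain l where l: "?P l" using asm(3) by blast
      have "(u 1 2 - l) * (u 2 3 - l) \<le> (u 1 2 - l) * (u 3 4 - l)"
        using l asm mult_right_mono[of "u 1 2 - l" "u 1 4 - l" "u 2 3 - l"] by simp
      moreover have "(u 1 2 - l) * (u 1 4 - l) \<le> (u 1 2 - l) * (u 3 4 - l)"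
        using l asm mult_left_mono[of "u 1 2 - l" "u 2 3 - l" "u 1 4 - l"] by (simp add: mult.commute)
      moreover have "0 < u 1 2 - l" using l by simp
      ultimately show ?thesis using mult_le_cancel_left_pos[of "u 1 2 - l"] by simp
    qed
    have "normalized_convex_cc s \<longleftrightarrow>
        u 1 2 \<le> u 1 4 \<and> u 1 2 \<le> u 2 3 \<and> u 1 2 \<le> u 3 4 \<and> (\<exists>l. ?P l)"
      unfolding s normalized_convex_cc_def prod.case cc using pos by (simp add: le)
    also have "\<dots> \<longleftrightarrow> u 1 3 < u 1 2 \<and> u 2 4 < u 1 2 \<and> u 1 2 \<le> u 1 4 \<and> u 1 4 \<le> u 3 4 \<and>
        u 1 2 \<le> u 2 3 \<and> u 2 3 \<le> u 3 4 \<and> F_fun s = 0"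
      using order unfolding involution_iff s F_fun_eq_0_iff[OF pos] u_def[symmetric] by auto
    also have "\<dots> \<longleftrightarrow> s \<in> E_set"
      unfolding s E_set_def C_set_def using pos by (simp add: le less)
    finally show ?thesis .
  qed
qed

section \<open>Roots as implicit functions of the parameters\<close>

text \<open>The signs of \<open>G\<close> at \<open>f x - d\<close> and \<open>f x + d\<close>
  persist for \<open>y\<close> near \<open>x\<close>, and monotonicity traps the root
  \<open>f y\<close> between them. The set \<open>S\<close> is arbitrary because
  \<open>D_set\<close> contains boundary points, for instance some with
  \<open>c = a\<close>.\<close>

lemma implicit_function_continuous:
  fixes G :: "'a::metric_space \<times> real \<Rightarrow> real"
  assumes "open \<Omega>" "continuous_on \<Omega> G"
    and mono: "\<And>x s t. \<lbrakk>(x, s) \<in> \<Omega>; (x, t) \<in> \<Omega>; s < t\<rbrakk> \<Longrightarrow> G (x, s) < G (x, t)"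
    and root: "\<And>x. x \<in> S \<Longrightarrow> (x, f x) \<in> \<Omega> \<and> G (x, f x) = 0"
  shows "continuous_on S f"
  unfolding continuous_on_iff
proof (intro ballI allI impI)
  fix x e assume x: "x \<in> S" and "0 < (e::real)"
  obtain r where r: "0 < r" "\<And>p. dist p (x, f x) < r \<Longrightarrow> p \<in> \<Omega>"
    using assms(1) root[OF x] unfolding open_dist by blast
  define d where "d = min e r / 2"
  have d: "0 < d" "d < e" "d < r" using \<open>0 < e\<close> r(1) by (auto simp: d_def min_def)
  have in\<Omega>: "(x, f x - d) \<in> \<Omega>" "(x, f x + d) \<in> \<Omega>"
    using d by (auto intro!: r(2) simp: dist_Pair_Pair dist_real_def)
  have sgn: "G (x, f x - d) < 0" "0 < G (x, f x + d)"
    using mono[OF in\<Omega>(1), of "f x"] mono[OF _ in\<Omega>(2), of "f x"] root[OF x] d by auto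
  have ev: "\<forall>\<^sub>F y in nhds x. (y, t) \<in> \<Omega>" "((\<lambda>y. G (y, t)) \<longlongrightarrow> G (x, t)) (nhds x)"
    if "(x, t) \<in> \<Omega>" for t
  proof -
    have lim: "((\<lambda>y. (y, t)) \<longlongrightarrow> (x, t)) (nhds x)" by (intro tendsto_intros filterlim_ident)
    then show "\<forall>\<^sub>F y in nhds x. (y, t) \<in> \<Omega>"
      using assms(1) that topological_tendstoD by blast
    have "isCont G (x, t)" using assms(1,2) that continuous_on_eq_continuous_at by blast
    then show "((\<lambda>y. G (y, t)) \<longlongrightarrow> G (x, t)) (nhds x)"
      using isCont_tendsto_compose lim by blast
  qed
  have "\<forall>\<^sub>F y in nhds x. (y, f x - d) \<in> \<Omega> \<and> (y, f x + d) \<in> \<Omega> \<and> G (y, f x - d) < 0 \<and> 0 < G (y, f x + d)"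
    using ev in\<Omega> sgn by (auto intro!: eventually_conj order_tendstoD)
  then obtain \<delta> where \<delta>: "0 < \<delta>" "\<And>y. dist y x < \<delta> \<Longrightarrow> (y, f x - d) \<in> \<Omega> \<and> (y, f x + d) \<in> \<Omega> \<and>
      G (y, f x - d) < 0 \<and> 0 < G (y, f x + d)"
    unfolding eventually_nhds_metric by blast
  have "dist (f y) (f x) < e" if y: "y \<in> S" "dist y x < \<delta>" for y
  proof -
    note \<delta>y = \<delta>(2)[OF y(2)]
    have "f x - d < f y" using \<delta>y mono[of y "f y" "f x - d"] root[OF y(1)] by (cases "f y = f x - d") force+
    moreover have "f y < f x + d" using \<delta>y mono[of y "f x + d" "f y"] root[OF y(1)] by (cases "f y = f x + d") force+
    ultimately show ?thesis using d by (simp add: dist_real_def)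
  qed
  then show "\<exists>\<delta>>0. \<forall>y\<in>S. dist y x < \<delta> \<longrightarrow> dist (f y) (f x) < e" using \<delta>(1) by blast
qed

text \<open>Linearizing \<open>G\<close> along its zero set bounds \<open>G' (h, 0) + k * s\<close>
  by a small multiple of \<open>norm h + \<bar>s\<bar>\<close>. This first shows that
  \<open>s\<close> is at most linear in \<open>h\<close>, and then that the derivative of
  \<open>f\<close> is \<open>- G' (h, 0) / k\<close>.\<close>

lemma implicit_function_differentiable:
  fixes G :: "'a::real_normed_vector \<times> real \<Rightarrow> real"
  assumes G: "(G has_derivative G') (at (x, f x))" and k: "G' (0, 1) \<noteq> 0"
    and f: "continuous (at x within S) f" and x: "x \<in> S" and root: "\<And>y. y \<in> S \<Longrightarrow> G (y, f y) = 0"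
  shows "f differentiable (at x within S)"
proof -
  define k where "k = G' (0, 1)"
  have k: "0 < \<bar>k\<bar>" using assms(2) by (simp add: k_def)
  have bl: "bounded_linear G'" using G by (rule has_derivative_bounded_linear)
  have bl': "bounded_linear (\<lambda>h. G' (h, 0))"
    by (intro bounded_linear_compose[OF bl] bounded_linear_intros)
  have G'_eq: "G' (h, s) = G' (h, 0) + k * s" for h s
  proof -
    have "G' (h, s) = G' ((h, 0) + s *\<^sub>R (0, 1))" by simp
    also have "\<dots> = G' (h, 0) + s *\<^sub>R G' (0, 1)"
      using bl by (simp only: bounded_linear.linear linear_add linear_scale)
    finally show ?thesis by (simp add: k_def)
  qed
  obtain K where K: "0 \<le> K" "\<And>h. \<bar>G' (h, 0)\<bar> \<le> K * norm h"
    using bounded_linear.nonneg_bounded[OF bl'] by (auto simp: mult.commute)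
  define C where "C = 2 * K / \<bar>k\<bar> + 1"
  have C: "0 < C" using K k by (simp add: C_def add_nonneg_pos)
  have kC: "\<bar>k\<bar> * C = 2 * K + \<bar>k\<bar>" using k by (simp add: C_def distrib_left)
  have "(f has_derivative (\<lambda>h. - G' (h, 0) / k)) (at x within S)"
    unfolding has_derivative_within_alt
  proof (intro conjI allI impI)
    show "bounded_linear (\<lambda>h. - G' (h, 0) / k)"
      by (intro bounded_linear_divide[THEN bounded_linear_compose] bounded_linear_minus bl')
    fix e :: real assume e: "0 < e"
    \<comment> \<open>The bound \<open>\<bar>k\<bar> / 2\<close> lets the term in \<open>s\<close>
      be absorbed on the left, which gives \<open>\<bar>s\<bar> \<le> C * norm h\<close>; the other
      bound turns this into the final error \<open>e * norm h\<close>.\<close>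
    define \<epsilon> where "\<epsilon> = min (\<bar>k\<bar> / 2) (e * \<bar>k\<bar> / (1 + C))"
    have "\<epsilon> \<le> e * \<bar>k\<bar> / (1 + C)" unfolding \<epsilon>_def by simp
    then have \<epsilon>: "\<epsilon> * (1 + C) \<le> e * \<bar>k\<bar>" "0 < \<epsilon>" "\<epsilon> \<le> \<bar>k\<bar> / 2"
      using e k C by (simp add: pos_le_divide_eq, simp add: \<epsilon>_def, simp only: \<epsilon>_def min.cobounded1)
    obtain d where d: "0 < d" "\<And>p. norm (p - (x, f x)) < d \<Longrightarrow>
        norm (G p - G (x, f x) - G' (p - (x, f x))) \<le> \<epsilon> * norm (p - (x, f x))"
      using G \<epsilon>(2) unfolding has_derivative_at_alt by blast
    obtain \<delta> where \<delta>: "0 < \<delta>" "\<And>y. y \<in> S \<Longrightarrow> dist y x < \<delta> \<Longrightarrow> dist (f y) (f x) < d / 2"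
      using f d(1) unfolding continuous_within_eps_delta by (metis half_gt_zero)
    have "norm (f y - f x - - G' (y - x, 0) / k) \<le> e * norm (y - x)"
      if y: "y \<in> S" "norm (y - x) < min \<delta> (d / 2)" for y
    proof -
      define h s where "h = y - x" and "s = f y - f x"
      have nrm: "norm (h, s) \<le> norm h + \<bar>s\<bar>" using norm_Pair_le[of h s] by simp
      have "\<bar>s\<bar> < d / 2" using \<delta>(2)[OF y(1)] y(2) by (simp add: s_def dist_norm)
      then have "norm (h, s) < d" using nrm y(2) by (simp add: h_def)
      then have "norm (G (y, f y) - G (x, f x) - G' (h, s)) \<le> \<epsilon> * norm (h, s)"
        using d(2)[of "(y, f y)"] by (simp add: h_def s_def)
      then have "\<bar>G' (h, 0) + k * s\<bar> \<le> \<epsilon> * norm (h, s)"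
        using root[OF y(1)] root[OF x] by (simp add: G'_eq[of h s])
      also have "\<dots> \<le> \<epsilon> * (norm h + \<bar>s\<bar>)" using nrm \<epsilon>(2) by simp
      finally have *: "\<bar>G' (h, 0) + k * s\<bar> \<le> \<epsilon> * (norm h + \<bar>s\<bar>)" .
      have "\<bar>k\<bar> * \<bar>s\<bar> \<le> \<bar>G' (h, 0)\<bar> + \<epsilon> * (norm h + \<bar>s\<bar>)"
        using * by (simp flip: abs_mult)
      also have "\<dots> \<le> K * norm h + \<bar>k\<bar> / 2 * (norm h + \<bar>s\<bar>)"
        using K(2)[of h] \<epsilon>(3) by (intro add_mono mult_right_mono) auto
      finally have "\<bar>k\<bar> * \<bar>s\<bar> \<le> \<bar>k\<bar> * (C * norm h)"
        using kC by (simp add: distrib_left distrib_right flip: mult.assoc)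
      then have "\<bar>s\<bar> \<le> C * norm h" using k by simp
      then have "\<epsilon> * (norm h + \<bar>s\<bar>) \<le> \<epsilon> * ((1 + C) * norm h)"
        using \<epsilon>(2) by (simp add: algebra_simps)
      also have "\<dots> \<le> e * \<bar>k\<bar> * norm h"
        using mult_right_mono[OF \<epsilon>(1), of "norm h"] by (simp add: mult_ac)
      finally have "\<bar>k\<bar> * \<bar>s + G' (h, 0) / k\<bar> \<le> \<bar>k\<bar> * (e * norm h)"
        using * k by (simp add: algebra_simps flip: abs_mult)
      then show ?thesis using k by (simp add: h_def s_def)
    qed
    then show "\<exists>d>0. \<forall>y\<in>S. norm (y - x) < d \<longrightarrow>
        norm (f y - f x - - G' (y - x, 0) / k) \<le> e * norm (y - x)"
      using \<delta>(1) d(1) by (intro exI[of _ "min \<delta> (d / 2)"]) auto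
  qed
  then show ?thesis by (rule differentiableI)
qed

section \<open>Monotonicity in the cosine of the angle\<close>

text \<open>The argument is a squared distance, hence the exponent: the squared distances, unlike
  the distances, are affine in \<open>cos \<theta>\<close>.\<close>

definition inv_cube :: "real \<Rightarrow> real" where
  "inv_cube z = z powr (- 3 / 2)"

lemma inv_cube_power2: "0 < r \<Longrightarrow> inv_cube (r\<^sup>2) = 1 / r ^ 3"
  by (simp add: inv_cube_def powr_powr powr_minus_divide flip: powr_numeral)

lemma inv_cube_less_iff: "0 < x \<Longrightarrow> 0 < y \<Longrightarrow> inv_cube x < inv_cube y \<longleftrightarrow> y < x"
  unfolding inv_cube_def
  by (metis less_irrefl linorder_neqE_linordered_idom not_less_iff_gr_or_eq powr_less_mono2_neg
      divide_less_0_iff neg_less_0_iff_less zero_less_numeral)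

lemma inv_cube_le_iff: "0 < x \<Longrightarrow> 0 < y \<Longrightarrow> inv_cube x \<le> inv_cube y \<longleftrightarrow> y \<le> x"
  using inv_cube_less_iff[of y x] by (simp flip: not_less)

lemma inv_cube_has_real_derivative:
  assumes "0 < z"
  shows "(inv_cube has_real_derivative - 3 / 2 * z powr (- 5 / 2)) (at z)"
  using has_real_derivative_powr[OF assms, of "- 3 / 2"] unfolding inv_cube_def[abs_def] by simp

text \<open>The \<open>l\<close> that solves \<open>(x - l) * (y - l) = (d - l) * (e - l)\<close>.\<close>
definition multiplier :: "real \<Rightarrow> real \<Rightarrow> real \<Rightarrow> real \<Rightarrow> real" where
  "multiplier x y d e = (x * y - d * e) / (x + y - d - e)"

text \<open>The numerator of the quotient rule factors: the partial derivative in \<open>x\<close>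
  is \<open>(y - d) * (y - e) / (x + y - d - e)\<^sup>2\<close>, and symmetrically in
  \<open>y\<close>. So \<open>multiplier\<close> increases in both once these exceed
  \<open>d\<close> and \<open>e\<close>.\<close>

lemma multiplier_has_real_derivative:
  assumes "(X has_real_derivative x') (at t)" "(Y has_real_derivative y') (at t)"
    and "d < X t" "d < Y t" "e < X t" "e < Y t"
  shows "((\<lambda>t. multiplier (X t) (Y t) d e) has_real_derivative
    (x' * ((Y t - d) * (Y t - e)) + y' * ((X t - d) * (X t - e))) / (X t + Y t - d - e)\<^sup>2) (at t)"
  unfolding multiplier_def
  by (rule derivative_eq_intros assms refl)+
     (use assms in \<open>auto simp: power2_eq_square algebra_simps\<close>)

definition sq12 :: "real \<Rightarrow> real \<Rightarrow> real" where "sq12 a t = a\<^sup>2 - 2 * a * t + 1"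
definition sq34 :: "real \<Rightarrow> real \<Rightarrow> real \<Rightarrow> real" where "sq34 b c t = b\<^sup>2 - 2 * b * c * t + c\<^sup>2"
definition sq14 :: "real \<Rightarrow> real \<Rightarrow> real" where "sq14 c t = c\<^sup>2 + 2 * c * t + 1"
definition sq23 :: "real \<Rightarrow> real \<Rightarrow> real \<Rightarrow> real" where "sq23 a b t = a\<^sup>2 + 2 * a * b * t + b\<^sup>2"

lemmas sq_defs = sq12_def sq34_def sq14_def sq23_def

lemma cosine_law_pos:
  fixes x y t :: real
  assumes "0 < x" "0 < y" "-1 < t" "t < 1"
  shows "0 < x\<^sup>2 + 2 * x * y * t + y\<^sup>2" "0 < x\<^sup>2 - 2 * x * y * t + y\<^sup>2"
proof -
  have "0 < (x - y)\<^sup>2 + 2 * (x * y) * (1 + t)" "0 < (x - y)\<^sup>2 + 2 * (x * y) * (1 - t)"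
    using assms by (simp_all add: add_nonneg_pos)
  then show "0 < x\<^sup>2 + 2 * x * y * t + y\<^sup>2" "0 < x\<^sup>2 - 2 * x * y * t + y\<^sup>2"
    by (simp_all add: power2_eq_square algebra_simps)
qed

lemma sq_pos:
  assumes "0 < a" "0 < b" "0 < c" "-1 < t" "t < 1"
  shows "0 < sq12 a t" "0 < sq34 b c t" "0 < sq14 c t" "0 < sq23 a b t"
  using cosine_law_pos(2)[of a 1 t] cosine_law_pos(2)[of b c t] cosine_law_pos(1)[of c 1 t]
    cosine_law_pos(1)[of a b t] assms by (simp_all add: sq_defs)

text \<open>The difference of the multipliers demanded by the pairs 12, 34 and 14, 23. Parameters
  and \<open>t\<close> are paired in the form that the implicit function lemmas use.\<close>

definition gap :: "(real \<times> real \<times> real) \<times> real \<Rightarrow> real" where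
  "gap = (\<lambda>((a, b, c), t).
     multiplier (inv_cube (sq12 a t)) (inv_cube (sq34 b c t)) (inv_cube ((b + 1)\<^sup>2)) (inv_cube ((a + c)\<^sup>2)) -
     multiplier (inv_cube (sq14 c t)) (inv_cube (sq23 a b t)) (inv_cube ((b + 1)\<^sup>2)) (inv_cube ((a + c)\<^sup>2)))"

text \<open>An open set around the constraints of \<open>C_set\<close>, some of which are not
  strict. On it every exterior side is shorter than both diagonals, so both multipliers in
  \<open>gap\<close> have positive denominators.\<close>

definition long_diagonals :: "((real \<times> real \<times> real) \<times> real) set" where
  "long_diagonals = {((a, b, c), t). 0 < a \<and> 0 < b \<and> 0 < c \<and> -1 < t \<and> t < 1 \<and>
     sq12 a t < (b + 1)\<^sup>2 \<and> sq34 b c t < (b + 1)\<^sup>2 \<and> sq14 c t < (b + 1)\<^sup>2 \<and> sq23 a b t < (b + 1)\<^sup>2 \<and>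
     sq12 a t < (a + c)\<^sup>2 \<and> sq34 b c t < (a + c)\<^sup>2 \<and> sq14 c t < (a + c)\<^sup>2 \<and> sq23 a b t < (a + c)\<^sup>2}"

lemma open_long_diagonals: "open long_diagonals"
  unfolding long_diagonals_def split_def sq_defs
  by (intro open_Collect_conj open_Collect_less continuous_intros)

text \<open>All conditions are affine in \<open>t\<close>, so for a fixed first component they
  define an interval, along which \<open>gap\<close> can be compared by its derivative.\<close>

lemma long_diagonals_between:
  assumes "(x, s) \<in> long_diagonals" "(x, t) \<in> long_diagonals" "s \<le> r" "r \<le> t"
  shows "(x, r) \<in> long_diagonals"
proof -
  obtain a b c where x: "x = (a, b, c)" by (metis surj_pair)
  have pos: "0 < a" "0 < b" "0 < c" using assms unfolding x long_diagonals_def by auto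
  have "2 * a * s \<le> 2 * a * r" "2 * a * r \<le> 2 * a * t" "2 * b * c * s \<le> 2 * b * c * r" "2 * b * c * r \<le> 2 * b * c * t"
    "2 * c * s \<le> 2 * c * r" "2 * c * r \<le> 2 * c * t" "2 * a * b * s \<le> 2 * a * b * r" "2 * a * b * r \<le> 2 * a * b * t"
    using pos assms by simp_all
  then show ?thesis
    using assms unfolding x long_diagonals_def sq_defs mem_Collect_eq prod.case
    by (elim conjE, intro conjI; linarith)
qed

text \<open>As \<open>t\<close> grows, \<open>sq12\<close> and \<open>sq34\<close> shrink while
  \<open>sq14\<close> and \<open>sq23\<close> grow; the first multiplier therefore rises and the
  second falls.\<close>

lemma gap_has_positive_derivative:
  assumes "((a, b, c), t) \<in> long_diagonals"
  obtains g where "0 < g" "((\<lambda>t. gap ((a, b, c), t)) has_real_derivative g) (at t)"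
proof -
  have pos: "0 < a" "0 < b" "0 < c" "-1 < t" "t < 1"
    using assms unfolding long_diagonals_def by auto
  define d e where "d = inv_cube ((b + 1)\<^sup>2)" and "e = inv_cube ((a + c)\<^sup>2)"
  have sq: "0 < (b + 1)\<^sup>2" "0 < (a + c)\<^sup>2" using pos by simp_all
  have lin: "((\<lambda>s. inv_cube (\<alpha> + \<beta> * s)) has_real_derivative - 3 / 2 * (\<alpha> + \<beta> * t) powr (- 5 / 2) * \<beta>) (at t)"
    if "0 < \<alpha> + \<beta> * t" for \<alpha> \<beta>
    by (rule DERIV_chain2[where f = inv_cube and g = "\<lambda>s. \<alpha> + \<beta> * s"],
        rule inv_cube_has_real_derivative[OF that]) (auto intro!: derivative_eq_intros)
  have "\<exists>x>0. ((\<lambda>t. inv_cube (sq12 a t)) has_real_derivative x) (at t)"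
    using lin[of "a\<^sup>2 + 1" "- 2 * a"] sq_pos(1)[OF pos] pos
    by (intro exI conjI) (auto simp: sq_defs algebra_simps)
  then obtain x where x: "0 < x" "((\<lambda>t. inv_cube (sq12 a t)) has_real_derivative x) (at t)" by blast
  have "\<exists>y>0. ((\<lambda>t. inv_cube (sq34 b c t)) has_real_derivative y) (at t)"
    using lin[of "b\<^sup>2 + c\<^sup>2" "- 2 * b * c"] sq_pos(2)[OF pos] pos
    by (intro exI conjI) (auto simp: sq_defs algebra_simps)
  then obtain y where y: "0 < y" "((\<lambda>t. inv_cube (sq34 b c t)) has_real_derivative y) (at t)" by blast
  have "\<exists>z<0. ((\<lambda>t. inv_cube (sq14 c t)) has_real_derivative z) (at t)"
    using lin[of "c\<^sup>2 + 1" "2 * c"] sq_pos(3)[OF pos] pos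
    by (intro exI conjI) (auto simp: sq_defs algebra_simps)
  then obtain z where z: "z < 0" "((\<lambda>t. inv_cube (sq14 c t)) has_real_derivative z) (at t)" by blast
  have "\<exists>w<0. ((\<lambda>t. inv_cube (sq23 a b t)) has_real_derivative w) (at t)"
    using lin[of "a\<^sup>2 + b\<^sup>2" "2 * a * b"] sq_pos(4)[OF pos] pos
    by (intro exI conjI) (auto simp: sq_defs algebra_simps)
  then obtain w where w: "w < 0" "((\<lambda>t. inv_cube (sq23 a b t)) has_real_derivative w) (at t)" by blast
  have less: "d < inv_cube (sq12 a t)" "d < inv_cube (sq34 b c t)" "d < inv_cube (sq14 c t)" "d < inv_cube (sq23 a b t)"
    "e < inv_cube (sq12 a t)" "e < inv_cube (sq34 b c t)" "e < inv_cube (sq14 c t)" "e < inv_cube (sq23 a b t)"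
    using assms unfolding d_def e_def long_diagonals_def by (auto simp: inv_cube_less_iff[OF sq(1)] inv_cube_less_iff[OF sq(2)] sq_pos[OF pos])
  note D1 = multiplier_has_real_derivative[OF x(2) y(2) less(1,2,5,6)]
  note D2 = multiplier_has_real_derivative[OF z(2) w(2) less(3,4,7,8)]
  have "0 < (x * ((inv_cube (sq34 b c t) - d) * (inv_cube (sq34 b c t) - e)) +
      y * ((inv_cube (sq12 a t) - d) * (inv_cube (sq12 a t) - e))) /
      (inv_cube (sq12 a t) + inv_cube (sq34 b c t) - d - e)\<^sup>2" (is "0 < ?A")
    using x(1) y(1) less by (intro divide_pos_pos add_pos_pos mult_pos_pos zero_less_power) auto
  moreover have "(z * ((inv_cube (sq23 a b t) - d) * (inv_cube (sq23 a b t) - e)) +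
      w * ((inv_cube (sq14 c t) - d) * (inv_cube (sq14 c t) - e))) /
      (inv_cube (sq14 c t) + inv_cube (sq23 a b t) - d - e)\<^sup>2 < 0" (is "?B < 0")
    using z(1) w(1) less by (intro divide_neg_pos add_neg_neg mult_neg_pos mult_pos_pos zero_less_power) auto
  ultimately have "0 < ?A - ?B" by linarith
  then show thesis
    by (rule that) (unfold gap_def prod.case d_def[symmetric] e_def[symmetric], rule DERIV_diff[OF D1 D2])
qed

lemma gap_strict_mono:
  assumes "(x, s) \<in> long_diagonals" "(x, t) \<in> long_diagonals" "s < t"
  shows "gap (x, s) < gap (x, t)"
proof (rule DERIV_pos_imp_increasing[OF assms(3)])
  fix r assume r: "s \<le> r" "r \<le> t"
  obtain a b c where x: "x = (a, b, c)" by (metis surj_pair)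
  show "\<exists>g. ((\<lambda>r. gap (x, r)) has_real_derivative g) (at r) \<and> 0 < g"
    using gap_has_positive_derivative[of a b c r] long_diagonals_between[OF assms(1,2) r] unfolding x by metis
qed

lemma inv_cube_differentiable:
  fixes f :: "'a::real_normed_vector \<Rightarrow> real"
  assumes "f differentiable (at p)" "0 < f p"
  shows "(\<lambda>p. inv_cube (f p)) differentiable (at p)"
  using differentiable_compose[OF _ assms(1), of inv_cube] inv_cube_has_real_derivative[OF assms(2)]
  by (auto simp: real_differentiable_def)

lemma gap_differentiable:
  assumes "p \<in> long_diagonals"
  shows "gap differentiable (at p)"
proof -
  obtain a b c t where p: "p = ((a, b, c), t)" by (metis surj_pair)
  have pos: "0 < a" "0 < b" "0 < c" "-1 < t" "t < 1"
    using assms unfolding p long_diagonals_def by auto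
  have sq: "0 < (b + 1)\<^sup>2" "0 < (a + c)\<^sup>2" using pos by simp_all
  have less: "inv_cube ((b + 1)\<^sup>2) + inv_cube ((a + c)\<^sup>2) < inv_cube (sq12 a t) + inv_cube (sq34 b c t)"
     "inv_cube ((b + 1)\<^sup>2) + inv_cube ((a + c)\<^sup>2) < inv_cube (sq14 c t) + inv_cube (sq23 a b t)"
    using assms unfolding p long_diagonals_def
    by (auto intro!: add_strict_mono simp: inv_cube_less_iff[OF sq(1)] inv_cube_less_iff[OF sq(2)] sq_pos[OF pos])
  have proj: "(\<lambda>p :: (real \<times> real \<times> real) \<times> real. fst (fst p)) differentiable (at p)"
    "(\<lambda>p :: (real \<times> real \<times> real) \<times> real. fst (snd (fst p))) differentiable (at p)"
    "(\<lambda>p :: (real \<times> real \<times> real) \<times> real. snd (snd (fst p))) differentiable (at p)"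
    "(\<lambda>p :: (real \<times> real \<times> real) \<times> real. snd p) differentiable (at p)"
    by (intro bounded_linear_imp_differentiable bounded_linear_intros)+
  show ?thesis
    unfolding gap_def split_def multiplier_def sq_defs
    by (intro differentiable_diff differentiable_divide differentiable_add differentiable_mult
          inv_cube_differentiable differentiable_power proj differentiable_const)
       (use less sq sq_pos[OF pos] sq_defs in \<open>auto simp: p\<close>)
qed

section \<open>Signs of the balance equation\<close>

text \<open>The difference of the two sides in \<open>involution_iff\<close>. On inverse cubes it is
  \<open>F_fun\<close> up to the positive product of all cubed distances.\<close>

definition balance :: "real \<Rightarrow> real \<Rightarrow> real \<Rightarrow> real \<Rightarrow> real \<Rightarrow> real \<Rightarrow> real" where
  "balance x y z w d e = (x * y - d * e) * (z + w - d - e) - (z * w - d * e) * (x + y - d - e)"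

text \<open>The shape of \<open>F_fun\<close>. When two of the values coincide, one of the two
  products vanishes and the sign of the other is visible.\<close>

lemma balance_factor:
  "balance x y z w d e = (z - e) * (x - d) * (y - w) - (z - x) * (y - e) * (w - d)"
  unfolding balance_def by algebra

lemma balance_commute:
  "balance x y z w d e = balance x y w z d e" "balance x y z w d e = balance x y z w e d"
  unfolding balance_def by algebra+

text \<open>For the upper end of the range of \<open>t\<close>, where 12 is as long as 14 or
  23.\<close>

lemma balance_nonneg:
  assumes "x \<le> z" "z \<le> y" "x \<le> w" "w \<le> y" "d \<le> x" "e \<le> x" "x = z \<or> x = w"
  shows "0 \<le> balance x y z w d e"
  using assms(7)
proof
  assume "x = z"
  then show ?thesis using assms unfolding balance_factor by simp
next
  assume "x = w"
  then show ?thesis using assms by (subst balance_commute(1)) (simp add: balance_factor)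
qed

text \<open>For a lower end at which 34 is as long as 14 or 23.\<close>

lemma balance_nonpos:
  assumes "x \<le> z" "z \<le> y" "x \<le> w" "w \<le> y" "d \<le> x" "e \<le> x" "y = z \<or> y = w"
  shows "balance x y z w d e \<le> 0"
  using assms(7)
proof
  assume "y = w"
  then show ?thesis using assms unfolding balance_factor by simp
next
  assume "y = z"
  then show ?thesis using assms by (subst balance_commute(1)) (simp add: balance_factor)
qed

text \<open>For a lower end at which 12 is as long as a diagonal. Such a \<open>t\<close> is not
  admissible, and the strict sign keeps the root away from it.\<close>

lemma balance_neg:
  assumes "x < z" "z \<le> y" "x < w" "w \<le> y" "d \<le> x" "e \<le> x" "d = x \<or> e = x"
  shows "balance x y z w d e < 0"
  using assms(7)
proof
  assume "d = x"
  then show ?thesis using assms unfolding balance_factor by simp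
next
  assume "e = x"
  then show ?thesis using assms by (subst balance_commute(2)) (simp add: balance_factor)
qed

section \<open>The set E in terms of the cosine\<close>

definition quad_balance :: "real \<Rightarrow> real \<Rightarrow> real \<Rightarrow> real \<Rightarrow> real" where
  "quad_balance a b c t = balance (inv_cube (sq12 a t)) (inv_cube (sq34 b c t)) (inv_cube (sq14 c t))
     (inv_cube (sq23 a b t)) (inv_cube ((b + 1)\<^sup>2)) (inv_cube ((a + c)\<^sup>2))"

definition admissible :: "real \<Rightarrow> real \<Rightarrow> real \<Rightarrow> real \<Rightarrow> bool" where
  "admissible a b c t \<longleftrightarrow> sq12 a t < (b + 1)\<^sup>2 \<and> sq12 a t < (a + c)\<^sup>2 \<and>
     sq14 c t \<le> sq12 a t \<and> sq34 b c t \<le> sq14 c t \<and> sq23 a b t \<le> sq12 a t \<and> sq34 b c t \<le> sq23 a b t"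

lemma E_set_iff:
  "(a, b, c, \<theta>) \<in> E_set \<longleftrightarrow> 0 < a \<and> 0 < b \<and> 0 < c \<and> 0 < \<theta> \<and> \<theta> < pi \<and>
     admissible a b c (cos \<theta>) \<and> quad_balance a b c (cos \<theta>) = 0"
proof (cases "0 < a \<and> 0 < b \<and> 0 < c \<and> 0 < \<theta> \<and> \<theta> < pi")
  case False
  then show ?thesis unfolding E_set_def C_set_def by auto
next
  case True
  then have pos: "0 < a" "0 < b" "0 < c" "0 < \<theta>" "\<theta> < pi" by auto
  have side: "side a b c \<theta> 1 2 = sqrt (sq12 a (cos \<theta>))" "side a b c \<theta> 3 4 = sqrt (sq34 b c (cos \<theta>))"
    "side a b c \<theta> 1 4 = sqrt (sq14 c (cos \<theta>))" "side a b c \<theta> 2 3 = sqrt (sq23 a b (cos \<theta>))"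
    "side a b c \<theta> 1 3 = sqrt ((b + 1)\<^sup>2)" "side a b c \<theta> 2 4 = sqrt ((a + c)\<^sup>2)"
    unfolding sq_defs by (rule real_sqrt_unique[symmetric], rule side_squared, simp add: rdist_def)+
  have inv: "1 / sqrt z ^ 3 = inv_cube z" if "0 < z" for z
    using inv_cube_power2[of "sqrt z"] that by simp
  have sq: "0 < (b + 1)\<^sup>2" "0 < (a + c)\<^sup>2" using pos by simp_all
  note inv = sq_pos[OF pos(1-3) cos_bounds[OF pos(4,5)], THEN inv] sq[THEN inv]
  have "F_fun (a, b, c, \<theta>) = 0 \<longleftrightarrow> quad_balance a b c (cos \<theta>) = 0"
    unfolding F_fun_eq_0_iff[OF pos] side inv quad_balance_def balance_def by simp
  then show ?thesis
    unfolding E_set_def C_set_def admissible_def using pos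
    by (simp only: mem_Collect_eq prod.case side real_sqrt_less_iff real_sqrt_le_iff) auto
qed

lemma admissible_long_diagonals:
  assumes "0 < a" "0 < b" "0 < c" "-1 < t" "t < 1" "admissible a b c t"
  shows "((a, b, c), t) \<in> long_diagonals"
  using assms unfolding admissible_def long_diagonals_def by auto

lemma gap_eq_0_iff:
  assumes "((a, b, c), t) \<in> long_diagonals"
  shows "gap ((a, b, c), t) = 0 \<longleftrightarrow> quad_balance a b c t = 0"
proof -
  have pos: "0 < a" "0 < b" "0 < c" "-1 < t" "t < 1"
    using assms unfolding long_diagonals_def by auto
  have sq: "0 < (b + 1)\<^sup>2" "0 < (a + c)\<^sup>2" using pos by simp_all
  have less: "inv_cube ((b + 1)\<^sup>2) + inv_cube ((a + c)\<^sup>2) < inv_cube (sq12 a t) + inv_cube (sq34 b c t)"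
     "inv_cube ((b + 1)\<^sup>2) + inv_cube ((a + c)\<^sup>2) < inv_cube (sq14 c t) + inv_cube (sq23 a b t)"
    using assms unfolding long_diagonals_def
    by (auto intro!: add_strict_mono simp: inv_cube_less_iff[OF sq(1)] inv_cube_less_iff[OF sq(2)] sq_pos[OF pos])
  show ?thesis
    unfolding gap_def prod.case multiplier_def quad_balance_def balance_def
    using less by (simp add: frac_eq_eq)
qed

section \<open>Bounds on the cosine and the set D\<close>

lemma le_iff_of_diff:
  fixes x y u v k :: real
  assumes "y - x = k * (v - u)" "0 < k"
  shows "x \<le> y \<longleftrightarrow> u \<le> v"
proof -
  have "x \<le> y \<longleftrightarrow> 0 \<le> k * (v - u)" using assms(1) by linarith
  then show ?thesis using assms(2) by (simp add: zero_le_mult_iff)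
qed

lemma less_iff_of_diff:
  fixes x y u v k :: real
  assumes "y - x = k * (v - u)" "0 < k"
  shows "x < y \<longleftrightarrow> u < v"
proof -
  have "x < y \<longleftrightarrow> 0 < k * (v - u)" using assms(1) by linarith
  then show ?thesis using assms(2) by (simp add: zero_less_mult_iff)
qed

text \<open>Each difference is a positive slope times the signed distance of \<open>t\<close> from
  its zero, so every condition in \<open>admissible\<close> becomes a bound on \<open>t\<close>. The
  third and fifth are upper bounds, the others lower bounds.\<close>

lemma sq_diffs:
  assumes "0 < a" "0 < b" "0 < c"
  shows "(b + 1)\<^sup>2 - sq12 a t = 2 * a * (t - (a\<^sup>2 + 1 - (b + 1)\<^sup>2) / (2 * a))"
    "(a + c)\<^sup>2 - sq12 a t = 2 * a * (t - (a\<^sup>2 + 1 - (a + c)\<^sup>2) / (2 * a))"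
    "sq12 a t - sq14 c t = 2 * (a + c) * ((a - c) / 2 - t)"
    "sq14 c t - sq34 b c t = 2 * c * (1 + b) * (t - (b - 1) / (2 * c))"
    "sq12 a t - sq23 a b t = 2 * a * (1 + b) * ((1 - b) / (2 * a) - t)"
    "sq23 a b t - sq34 b c t = 2 * b * (a + c) * (t - (c - a) / (2 * b))"
  using assms by (simp_all add: sq_defs field_simps power2_eq_square)

lemma admissible_iff:
  assumes "0 < a" "0 < b" "0 < c"
  shows "admissible a b c t \<longleftrightarrow> (a\<^sup>2 + 1 - (b + 1)\<^sup>2) / (2 * a) < t \<and> (a\<^sup>2 + 1 - (a + c)\<^sup>2) / (2 * a) < t \<and>
     t \<le> (a - c) / 2 \<and> (b - 1) / (2 * c) \<le> t \<and> t \<le> (1 - b) / (2 * a) \<and> (c - a) / (2 * b) \<le> t"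
  using assms unfolding admissible_def
  by (simp add: sq_diffs[OF assms, THEN less_iff_of_diff] sq_diffs[OF assms, THEN le_iff_of_diff])

text \<open>\<open>sqrt\<close> is odd, so negative radicands such as
  \<open>4 - 3 * a\<^sup>2\<close> for large \<open>a\<close> are covered.\<close>

lemma sqrt_less_iff: "0 < y \<Longrightarrow> sqrt x < y \<longleftrightarrow> x < y\<^sup>2"
  by (metis abs_of_pos real_sqrt_abs real_sqrt_less_iff)

text \<open>Squaring removes the roots. For \<open>a \<le> 1\<close> the inequality
  \<open>a\<^sup>2 < 1 + b + b\<^sup>2\<close> is automatic, and for \<open>a > 1\<close> so is
  \<open>1 < a\<^sup>2 + a * c + c\<^sup>2\<close>; hence \<open>D1_set\<close> and
  \<open>D2_set\<close> merge into one system.\<close>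

lemma D_set_iff:
  "(a, b, c) \<in> D_set \<longleftrightarrow> 0 < a \<and> 0 < b \<and> 0 < c \<and> c \<le> a \<and> b \<le> 1 \<and>
     a * c < b\<^sup>2 + 2 * b \<and> a\<^sup>2 < 1 + b + b\<^sup>2 \<and> 1 < a\<^sup>2 + a * c + c\<^sup>2 \<and> b < c\<^sup>2 + 2 * a * c"
proof (cases "0 < a \<and> 0 < b \<and> 0 < c")
  case False
  then show ?thesis unfolding D_set_def D1_set_def D2_set_def by auto
next
  case True
  then have pos: "0 < a" "0 < b" "0 < c" by auto
  have 1: "1 / 2 * (- a + sqrt (4 - 3 * a\<^sup>2)) < c \<longleftrightarrow> 1 < a\<^sup>2 + a * c + c\<^sup>2"
    using sqrt_less_iff[of "2 * c + a" "4 - 3 * a\<^sup>2"] pos by (simp add: power2_eq_square algebra_simps) argo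
  have 2: "1 / 2 * (- 1 + sqrt (4 * a\<^sup>2 - 3)) < b \<longleftrightarrow> a\<^sup>2 < 1 + b + b\<^sup>2"
    using sqrt_less_iff[of "2 * b + 1" "4 * a\<^sup>2 - 3"] pos by (simp add: power2_eq_square algebra_simps) argo
  have 3: "- a + sqrt (a\<^sup>2 + b) < c \<longleftrightarrow> b < c\<^sup>2 + 2 * a * c"
    using sqrt_less_iff[of "c + a" "a\<^sup>2 + b"] pos by (simp add: power2_eq_square algebra_simps)
  have 4: "c < 1 / a * (b\<^sup>2 + 2 * b) \<longleftrightarrow> a * c < b\<^sup>2 + 2 * b"
    using pos by (simp add: pos_less_divide_eq mult.commute)
  have 5: "a\<^sup>2 < 1 + b + b\<^sup>2" if "a \<le> 1"
  proof -
    have "a\<^sup>2 \<le> 1" using power_mono[OF that, of 2] pos by simp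
    then show ?thesis using pos(2) zero_less_power[OF pos(2), of 2] by linarith
  qed
  have 6: "1 < a\<^sup>2 + a * c + c\<^sup>2" if "1 < a"
  proof -
    have "1 < a\<^sup>2" using that by simp
    then show ?thesis using zero_less_power[OF pos(3), of 2] mult_pos_pos[OF pos(1,3)] by linarith
  qed
  show ?thesis
    unfolding D_set_def D1_set_def D2_set_def Un_iff mem_Collect_eq prod.case 1 2 3 4
    using pos 5 6 by force
qed

text \<open>Each inequality of D compares a lower bound on \<open>t\<close> with an upper bound: two
  comparisons of non-strict bounds give \<open>c \<le> a\<close> and \<open>b \<le> 1\<close>, and
  the four with a strict lower bound give the remaining inequalities.\<close>

lemma admissible_imp_D_set:
  assumes pos: "0 < a" "0 < b" "0 < c" and adm: "admissible a b c t"
  shows "(a, b, c) \<in> D_set"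
proof -
  note t = adm[unfolded admissible_iff[OF pos]]
  have "(c - a) / (2 * b) \<le> (a - c) / 2" using t by linarith
  then have "(1 + b) * (c - a) \<le> 0" using pos by (simp add: field_simps)
  then have "c \<le> a" using pos by (simp add: mult_le_0_iff)
  have "(b - 1) / (2 * c) \<le> (1 - b) / (2 * a)" using t by linarith
  then have "(a + c) * (b - 1) \<le> 0" using pos by (simp add: field_simps)
  then have "b \<le> 1" using pos by (simp add: mult_le_0_iff)
  have "(a\<^sup>2 + 1 - (b + 1)\<^sup>2) / (2 * a) < (a - c) / 2" "(a\<^sup>2 + 1 - (b + 1)\<^sup>2) / (2 * a) < (1 - b) / (2 * a)"
    "(a\<^sup>2 + 1 - (a + c)\<^sup>2) / (2 * a) < (a - c) / 2" "(a\<^sup>2 + 1 - (a + c)\<^sup>2) / (2 * a) < (1 - b) / (2 * a)"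
    using t by linarith+
  then have "a * c < b\<^sup>2 + 2 * b" "a\<^sup>2 < 1 + b + b\<^sup>2" "1 < a\<^sup>2 + a * c + c\<^sup>2" "b < c\<^sup>2 + 2 * a * c"
    using pos by (simp_all add: divide_simps) (simp_all add: power2_eq_square algebra_simps)
  then show ?thesis using pos \<open>c \<le> a\<close> \<open>b \<le> 1\<close> unfolding D_set_iff by simp
qed

text \<open>The inequalities of D make the interval from \<open>lo\<close> to \<open>hi\<close>
  nonempty, and the intermediate value theorem finds a root in it.\<close>

lemma admissible_root_exists:
  assumes "(a, b, c) \<in> D_set"
  obtains t where "-1 < t" "t < 1" "admissible a b c t" "quad_balance a b c t = 0"
proof -
  have pos: "0 < a" "0 < b" "0 < c" and le: "c \<le> a" "b \<le> 1"
    and D: "a * c < b\<^sup>2 + 2 * b" "a\<^sup>2 < 1 + b + b\<^sup>2" "1 < a\<^sup>2 + a * c + c\<^sup>2" "b < c\<^sup>2 + 2 * a * c"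
    using assms unfolding D_set_iff by auto
  \<comment> \<open>At \<open>S1\<close>, \<open>S2\<close> the side 12 equals the diagonal 13,
    respectively 24; at \<open>A1\<close>, \<open>A2\<close> it equals 14, respectively 23; at
    \<open>B1\<close>, \<open>B2\<close> the side 34 equals 14, respectively 23.\<close>
  define S1 where "S1 = (a\<^sup>2 + 1 - (b + 1)\<^sup>2) / (2 * a)"
  define S2 where "S2 = (a\<^sup>2 + 1 - (a + c)\<^sup>2) / (2 * a)"
  define A1 where "A1 = (a - c) / 2"
  define A2 where "A2 = (1 - b) / (2 * a)"
  define B1 where "B1 = (b - 1) / (2 * c)"
  define B2 where "B2 = (c - a) / (2 * b)"
  note defs = S1_def S2_def A1_def A2_def B1_def B2_def
  have SA: "S1 < A1" "S1 < A2" "S2 < A1" "S2 < A2"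
    unfolding defs using pos D by (simp_all add: divide_simps) (simp_all add: power2_eq_square algebra_simps)
  have signs: "0 \<le> A1" "0 \<le> A2" "B1 \<le> 0" "B2 \<le> 0"
    unfolding defs using pos le by (simp_all add: divide_le_0_iff)
  define lo hi where "lo = max (max S1 S2) (max B1 B2)" and "hi = min A1 A2"
  have lohi: "lo \<le> hi" using SA signs by (simp add: lo_def hi_def)
  \<comment> \<open>This makes \<open>t\<close> the cosine of an angle strictly between 0 and
    \<open>pi\<close>. A value \<open>t \<ge> 1\<close> would force both \<open>a \<ge> 2\<close>
    and \<open>2 * a \<le> 1\<close>, and \<open>t \<le> -1\<close> both
    \<open>c \<le> 1 / 2\<close> and \<open>c \<ge> 1\<close>.\<close>
  have bounds: "-1 < t" "t < 1" if "lo \<le> t" "t \<le> hi" for t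
  proof -
    show "t < 1"
    proof (rule ccontr)
      assume "\<not> t < 1"
      then have "1 \<le> A1" "1 \<le> A2" using that unfolding hi_def by auto
      then have "a \<ge> 2" "2 * a \<le> 1" using pos by (auto simp: A1_def A2_def divide_simps)
      then show False by simp
    qed
    show "-1 < t"
    proof (rule ccontr)
      assume "\<not> -1 < t"
      then have *: "B1 \<le> -1" "S2 \<le> -1" using that unfolding lo_def by auto
      have "c \<le> 1 / 2" using *(1) pos by (auto simp: B1_def divide_simps)
      moreover have "a\<^sup>2 + 1 - (a + c)\<^sup>2 \<le> - (2 * a)"
        using *(2) pos by (simp add: S2_def pos_divide_le_eq)
      then have "(a + 1)\<^sup>2 \<le> (a + c)\<^sup>2" unfolding power2_sum[of a 1] one_power2 by linarith
      then have "a + 1 \<le> a + c" using pos by (auto dest: power2_le_imp_le)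
      ultimately show False by simp
    qed
  qed
  note diffs = sq_diffs[OF pos, folded defs]
  have inv_sq_pos: "0 < sq12 a t" "0 < sq34 b c t" "0 < sq14 c t" "0 < sq23 a b t" "0 < (b + 1)\<^sup>2" "0 < (a + c)\<^sup>2"
    if "lo \<le> t" "t \<le> hi" for t
    using sq_pos[OF pos bounds[OF that]] pos by simp_all
  have order: "inv_cube (sq12 a t) \<le> inv_cube (sq14 c t)" "inv_cube (sq14 c t) \<le> inv_cube (sq34 b c t)"
    "inv_cube (sq12 a t) \<le> inv_cube (sq23 a b t)" "inv_cube (sq23 a b t) \<le> inv_cube (sq34 b c t)"
    "inv_cube ((b + 1)\<^sup>2) \<le> inv_cube (sq12 a t)" "inv_cube ((a + c)\<^sup>2) \<le> inv_cube (sq12 a t)"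
    if t: "lo \<le> t" "t \<le> hi" for t
    using t pos unfolding lo_def hi_def
    by (auto simp: inv_cube_le_iff inv_sq_pos[OF t] diffs[THEN le_iff_of_diff])
  \<comment> \<open>The bounds \<open>S1\<close>, \<open>S2\<close> are excluded from the admissible
    range. If one of them is \<open>lo\<close>, strict negativity keeps the root off it; otherwise
    \<open>lo\<close> already lies above both.\<close>
  have lo: "quad_balance a b c lo \<le> 0 \<and> (max B1 B2 \<le> max S1 S2 \<longrightarrow> quad_balance a b c lo < 0)"
  proof (cases "max B1 B2 \<le> max S1 S2")
    case True
    then have lo_eq: "lo = max S1 S2" by (simp add: lo_def)
    then have "lo < A1" "lo < A2" using SA by auto
    then have "inv_cube (sq12 a lo) < inv_cube (sq14 c lo)" "inv_cube (sq12 a lo) < inv_cube (sq23 a b lo)"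
      using pos by (auto simp: inv_cube_less_iff inv_sq_pos[OF order.refl lohi] diffs[THEN less_iff_of_diff])
    moreover have "(b + 1)\<^sup>2 = sq12 a lo \<or> (a + c)\<^sup>2 = sq12 a lo"
      using diffs(1,2)[of lo] lo_eq by (auto simp: max_def split: if_splits)
    ultimately have "quad_balance a b c lo < 0"
      unfolding quad_balance_def using order[OF order.refl lohi] by (intro balance_neg) auto
    then show ?thesis by simp
  next
    case False
    then have "lo = B1 \<or> lo = B2" unfolding lo_def by linarith
    then have "sq34 b c lo = sq14 c lo \<or> sq34 b c lo = sq23 a b lo"
      using diffs(4,6)[of lo] by auto
    then have "quad_balance a b c lo \<le> 0"
      unfolding quad_balance_def using order[OF order.refl lohi] by (intro balance_nonpos) auto
    then show ?thesis using False by blast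
  qed
  have hi: "0 \<le> quad_balance a b c hi"
  proof -
    have "hi = A1 \<or> hi = A2" unfolding hi_def by linarith
    then have "sq12 a hi = sq14 c hi \<or> sq12 a hi = sq23 a b hi"
      using diffs(3,5)[of hi] by auto
    then show ?thesis
      unfolding quad_balance_def using order[OF lohi order.refl] by (intro balance_nonneg) auto
  qed
  have "continuous_on {lo..hi} (\<lambda>t. inv_cube (f t))"
    if "continuous_on {lo..hi} f" "\<And>t. lo \<le> t \<Longrightarrow> t \<le> hi \<Longrightarrow> 0 < f t" for f
    unfolding inv_cube_def using that by (intro continuous_on_powr continuous_on_const) force+
  moreover have "continuous_on {lo..hi} (sq12 a)" "continuous_on {lo..hi} (sq34 b c)"
    "continuous_on {lo..hi} (sq14 c)" "continuous_on {lo..hi} (sq23 a b)"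
    unfolding sq_defs[abs_def] by (intro continuous_intros)+
  ultimately have "continuous_on {lo..hi} (quad_balance a b c)"
    unfolding quad_balance_def[abs_def] balance_def
    by (intro continuous_intros) (use inv_sq_pos in auto)
  then obtain t where t: "lo \<le> t" "t \<le> hi" "quad_balance a b c t = 0"
    using IVT'[of "quad_balance a b c" lo 0 hi] lo hi lohi by blast
  moreover have "max S1 S2 < t"
  proof (cases "max B1 B2 \<le> max S1 S2")
    case True
    then have "lo \<noteq> t" "lo = max S1 S2" using lo t(3) by (auto simp: lo_def)
    then show ?thesis using t(1) by linarith
  next
    case False
    then show ?thesis using t(1) by (auto simp: lo_def)
  qed
  then have "admissible a b c t"
    unfolding admissible_iff[OF pos] using t(1,2) unfolding lo_def hi_def defs by simp
  ultimately show thesis using that bounds by blast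
qed

section \<open>Existence, uniqueness and differentiability of the angle\<close>

lemma normalized_convex_cc_iff:
  "normalized_convex_cc (a, b, c, \<theta>) \<longleftrightarrow> 0 < a \<and> 0 < b \<and> 0 < c \<and> 0 < \<theta> \<and> \<theta> < pi \<and>
     admissible a b c (cos \<theta>) \<and> quad_balance a b c (cos \<theta>) = 0"
  unfolding normalized_convex_cc_iff_E_set E_set_iff ..

lemma normalized_convex_cc_root:
  assumes "normalized_convex_cc (a, b, c, \<theta>)"
  shows "((a, b, c), cos \<theta>) \<in> long_diagonals" "gap ((a, b, c), cos \<theta>) = 0"
proof -
  have pos: "0 < a" "0 < b" "0 < c" "0 < \<theta>" "\<theta> < pi" and
    t: "admissible a b c (cos \<theta>)" "quad_balance a b c (cos \<theta>) = 0"
    using assms unfolding normalized_convex_cc_iff by auto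
  show *: "((a, b, c), cos \<theta>) \<in> long_diagonals"
    by (rule admissible_long_diagonals[OF pos(1-3) cos_bounds[OF pos(4,5)] t(1)])
  show "gap ((a, b, c), cos \<theta>) = 0" using gap_eq_0_iff[OF *] t(2) by simp
qed

lemma normalized_convex_cc_unique:
  assumes "normalized_convex_cc (a, b, c, \<theta>)" "normalized_convex_cc (a, b, c, \<phi>)"
  shows "\<theta> = \<phi>"
proof -
  have "cos \<theta> = cos \<phi>"
    using gap_strict_mono normalized_convex_cc_root[OF assms(1)] normalized_convex_cc_root[OF assms(2)]
    by (metis less_irrefl linorder_neqE_linordered_idom)
  then show ?thesis
    using assms unfolding normalized_convex_cc_iff by (auto intro: cos_inj_pi)
qed

lemma normalized_convex_cc_ex1:
  assumes "(a, b, c) \<in> D_set"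
  shows "\<exists>!\<theta>. normalized_convex_cc (a, b, c, \<theta>)"
proof -
  obtain t where t: "-1 < t" "t < 1" "admissible a b c t" "quad_balance a b c t = 0"
    using admissible_root_exists[OF assms] .
  then have "0 < arccos t" "arccos t < pi" "cos (arccos t) = t"
    using arccos_lt_bounded[of t] by auto
  then have "normalized_convex_cc (a, b, c, arccos t)"
    using assms t unfolding normalized_convex_cc_iff D_set_iff by simp
  then show ?thesis using normalized_convex_cc_unique by blast
qed

lemma normalized_convex_cc_imp_D_set: "normalized_convex_cc (a, b, c, \<theta>) \<Longrightarrow> (a, b, c) \<in> D_set"
  unfolding normalized_convex_cc_iff using admissible_imp_D_set by blast

text \<open>The implicit function lemmas apply to \<open>cos (f x)\<close>, the root of
  \<open>gap\<close>; composing with \<open>arccos\<close>, which is differentiable strictly between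
  -1 and 1, recovers \<open>f\<close>.\<close>

lemma root_differentiable_on:
  assumes "\<And>a b c. (a, b, c) \<in> S \<Longrightarrow> normalized_convex_cc (a, b, c, f (a, b, c))"
  shows "f differentiable_on S"
proof -
  define \<tau> where "\<tau> x = cos (f x)" for x
  have root: "(x, \<tau> x) \<in> long_diagonals \<and> gap (x, \<tau> x) = 0" if "x \<in> S" for x
    using normalized_convex_cc_root assms that unfolding \<tau>_def by (cases x) auto
  have f: "f x = arccos (\<tau> x)" "-1 < \<tau> x" "\<tau> x < 1" if "x \<in> S" for x
  proof -
    have "0 < f x \<and> f x < pi"
      using assms that unfolding normalized_convex_cc_iff by (cases x) auto
    then show "f x = arccos (\<tau> x)" "-1 < \<tau> x" "\<tau> x < 1"
      unfolding \<tau>_def by (auto simp: arccos_cos cos_bounds)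
  qed
  have "continuous_on long_diagonals gap"
    using gap_differentiable differentiable_imp_continuous_within
    by (intro continuous_at_imp_continuous_on) blast
  then have cont: "continuous_on S \<tau>"
    by (rule implicit_function_continuous[OF open_long_diagonals _ gap_strict_mono root])
  show ?thesis
    unfolding differentiable_on_def
  proof
    fix x assume x: "x \<in> S"
    obtain a b c where abc: "x = (a, b, c)" by (metis surj_pair)
    obtain G' where G': "(gap has_derivative G') (at (x, \<tau> x))"
      using gap_differentiable root[OF x] unfolding differentiable_def by blast
    obtain g where g: "0 < g" "((\<lambda>t. gap (x, t)) has_real_derivative g) (at (\<tau> x))"
      using gap_has_positive_derivative root[OF x] unfolding abc by metis
    \<comment> \<open>Restricting to the line \<open>t \<mapsto> (x, t)\<close> identifies
      \<open>G' (0, 1)\<close> with the positive derivative \<open>g\<close>, so it does not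
      vanish.\<close>
    have "((\<lambda>t. (x, t)) has_derivative (\<lambda>t. (0, t))) (at (\<tau> x))"
      by (intro derivative_eq_intros) auto
    from has_derivative_compose[OF this G']
    have "((\<lambda>t. gap (x, t)) has_derivative (\<lambda>t. G' (0, t))) (at (\<tau> x))" .
    from has_derivative_unique[OF this g(2)[unfolded has_field_derivative_def]]
    have "G' (0, 1) = g * 1" by metis
    then have "\<tau> differentiable (at x within S)"
      using implicit_function_differentiable[where f = \<tau>, OF G' _ _ x] cont x g(1) root
      by (auto simp: continuous_on_eq_continuous_within)
    moreover have "arccos differentiable (at (\<tau> x) within \<tau> ` S)"
      using DERIV_arccos[OF f(2,3)[OF x]] by (meson differentiable_at_withinI real_differentiable_def)
    ultimately have "(\<lambda>y. arccos (\<tau> y)) differentiable (at x within S)"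
      using differentiable_chain_within[of \<tau> x S arccos] by (simp add: o_def)
    then obtain f' where f': "((\<lambda>y. arccos (\<tau> y)) has_derivative f') (at x within S)"
      unfolding differentiable_def by blast
    have "(f has_derivative f') (at x within S)"
      by (rule has_derivative_transform[OF x _ f']) (simp add: f(1))
    then show "f differentiable (at x within S)" by (rule differentiableI)
  qed
qed

theorem theorem3p6:
  shows "(\<forall>a b c. (a, b, c) \<in> D_set \<longrightarrow> (\<exists>!\<theta>. normalized_convex_cc (a, b, c, \<theta>)))
    \<and> (\<exists>f :: real \<times> real \<times> real \<Rightarrow> real.
          f differentiable_on D_set \<and>
          {s. normalized_convex_cc s} = {(a, b, c, \<theta>). (a, b, c) \<in> D_set \<and> \<theta> = f (a, b, c)})
    \<and> D_set = {(a, b, c). \<exists>\<theta>. 0 < \<theta> \<and> \<theta> < pi \<and> (a, b, c, \<theta>) \<in> E_set}"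
proof (intro conjI)
  show "\<forall>a b c. (a, b, c) \<in> D_set \<longrightarrow> (\<exists>!\<theta>. normalized_convex_cc (a, b, c, \<theta>))"
    using normalized_convex_cc_ex1 by blast
  define f where "f = (\<lambda>(a, b, c). THE \<theta>. normalized_convex_cc (a, b, c, \<theta>))"
  have f: "normalized_convex_cc (a, b, c, f (a, b, c))" if "(a, b, c) \<in> D_set" for a b c
    using theI'[OF normalized_convex_cc_ex1[OF that]] by (simp add: f_def)
  show "\<exists>f :: real \<times> real \<times> real \<Rightarrow> real. f differentiable_on D_set \<and>
      {s. normalized_convex_cc s} = {(a, b, c, \<theta>). (a, b, c) \<in> D_set \<and> \<theta> = f (a, b, c)}"
    using root_differentiable_on[of D_set f, OF f] f normalized_convex_cc_imp_D_set normalized_convex_cc_unique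
    by (intro exI[of _ f]) auto
  have "(a, b, c) \<in> D_set \<longleftrightarrow> (\<exists>\<theta>. 0 < \<theta> \<and> \<theta> < pi \<and> (a, b, c, \<theta>) \<in> E_set)" for a b c
  proof
    assume "(a, b, c) \<in> D_set"
    then have "normalized_convex_cc (a, b, c, f (a, b, c))" by (rule f)
    then show "\<exists>\<theta>. 0 < \<theta> \<and> \<theta> < pi \<and> (a, b, c, \<theta>) \<in> E_set"
      unfolding normalized_convex_cc_iff_E_set using E_set_iff by blast
  next
    assume "\<exists>\<theta>. 0 < \<theta> \<and> \<theta> < pi \<and> (a, b, c, \<theta>) \<in> E_set"
    then show "(a, b, c) \<in> D_set"
      unfolding normalized_convex_cc_iff_E_set[symmetric] using normalized_convex_cc_imp_D_set by blast
  qed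
  then show "D_set = {(a, b, c). \<exists>\<theta>. 0 < \<theta> \<and> \<theta> < pi \<and> (a, b, c, \<theta>) \<in> E_set}"
    by (simp only: set_eq_iff split_paired_all mem_Collect_eq prod.case) simp
qed

end
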